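(* Let $R$ be a right $a$-ring. Then $R$ is von Neumann regular if and only if $R$ is semiprime.
   Context: Rings are associative with identity. A right module $M$ is automorphism-invariant if $\varphi(M)\subseteq M$ for every automorphism $\varphi$ of its injective envelope $E(M)$. A ring $R$ is a right $a$-ring if every right ideal of $R$ is automorphism-invariant as a right $R$-module. $R$ is von Neumann regular if for every $a\in R$ there is $b\in R$ with $a=aba$. $R$ is semiprime if it has no nonzero nilpotent (two-sided) ideals. *)

theory Defs
  imports "HOL-Algebra.Ideal_Product"
begin

section \<open>Right modules\<close>

text \<open>
  The modules of HOL-Algebra are left modules over commutative rings, hence the following
  right-handed version. As there, the multiplicative fields of a module record carry no meaning.
\<close>

record ('a, 'b) right_module = "'b ring" +
  rsmult :: "'b \<Rightarrow> 'a \<Rightarrow> 'b" (infixl \<open>\<star>\<index>\<close> 70)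

locale right_module = R?: ring R + M?: abelian_group M
  for R :: "('a, 'r) ring_scheme" (structure) and M :: "('a, 'b, 'm) right_module_scheme" (structure) +
  assumes rsmult_closed [simp, intro]:
      "\<lbrakk>x \<in> carrier M; a \<in> carrier R\<rbrakk> \<Longrightarrow> x \<star>\<^bsub>M\<^esub> a \<in> carrier M"
    and rsmult_r_distr:
      "\<lbrakk>x \<in> carrier M; a \<in> carrier R; b \<in> carrier R\<rbrakk> \<Longrightarrow>
        x \<star>\<^bsub>M\<^esub> (a \<oplus> b) = x \<star>\<^bsub>M\<^esub> a \<oplus>\<^bsub>M\<^esub> x \<star>\<^bsub>M\<^esub> b"
    and rsmult_l_distr:
      "\<lbrakk>x \<in> carrier M; y \<in> carrier M; a \<in> carrier R\<rbrakk> \<Longrightarrow>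
        (x \<oplus>\<^bsub>M\<^esub> y) \<star>\<^bsub>M\<^esub> a = x \<star>\<^bsub>M\<^esub> a \<oplus>\<^bsub>M\<^esub> y \<star>\<^bsub>M\<^esub> a"
    and rsmult_assoc:
      "\<lbrakk>x \<in> carrier M; a \<in> carrier R; b \<in> carrier R\<rbrakk> \<Longrightarrow>
        x \<star>\<^bsub>M\<^esub> (a \<otimes> b) = (x \<star>\<^bsub>M\<^esub> a) \<star>\<^bsub>M\<^esub> b"
    and rsmult_one [simp]: "x \<in> carrier M \<Longrightarrow> x \<star>\<^bsub>M\<^esub> \<one> = x"

definition right_submodule ::
    "('a, 'r) ring_scheme \<Rightarrow> ('a, 'b, 'm) right_module_scheme \<Rightarrow> 'b set \<Rightarrow> bool" where
  "right_submodule R M N \<longleftrightarrow>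
     additive_subgroup N M \<and> (\<forall>x\<in>N. \<forall>a\<in>carrier R. x \<star>\<^bsub>M\<^esub> a \<in> N)"

definition rmod_hom ::
    "('a, 'r) ring_scheme \<Rightarrow> ('a, 'b, 'm) right_module_scheme \<Rightarrow>
     ('a, 'c, 'n) right_module_scheme \<Rightarrow> ('b \<Rightarrow> 'c) set" where
  "rmod_hom R M N =
     {f. f \<in> carrier M \<rightarrow> carrier N \<and>
         (\<forall>x\<in>carrier M. \<forall>y\<in>carrier M. f (x \<oplus>\<^bsub>M\<^esub> y) = f x \<oplus>\<^bsub>N\<^esub> f y) \<and>
         (\<forall>x\<in>carrier M. \<forall>a\<in>carrier R. f (x \<star>\<^bsub>M\<^esub> a) = f x \<star>\<^bsub>N\<^esub> a)}"

definition rmod_mono ::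
    "('a, 'r) ring_scheme \<Rightarrow> ('a, 'b, 'm) right_module_scheme \<Rightarrow>
     ('a, 'c, 'n) right_module_scheme \<Rightarrow> ('b \<Rightarrow> 'c) set" where
  "rmod_mono R M N = {f \<in> rmod_hom R M N. inj_on f (carrier M)}"

definition rmod_aut ::
    "('a, 'r) ring_scheme \<Rightarrow> ('a, 'b, 'm) right_module_scheme \<Rightarrow> ('b \<Rightarrow> 'b) set" where
  "rmod_aut R M = {f \<in> rmod_hom R M M. bij_betw f (carrier M) (carrier M)}"


section \<open>Injective envelopes and automorphism-invariance\<close>

text \<open>
  A definition cannot quantify over modules of all types. Here the test modules \<open>A\<close>, \<open>B\<close> have
  their elements in the type of the ring, i.e. they are the modules (up to isomorphism) whose
  cardinality is at most that of this type. This loses nothing: lemma \<open>injective_extend\<close> below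
  derives the extension property for test modules over arbitrary types.
\<close>

definition injective_rmod ::
    "('a, 'r) ring_scheme \<Rightarrow> ('a, 'e, 'm) right_module_scheme \<Rightarrow> bool" where
  "injective_rmod R E \<longleftrightarrow> right_module R E \<and>
     (\<forall>(A :: ('a, 'a) right_module) (B :: ('a, 'a) right_module).
        right_module R A \<longrightarrow> right_module R B \<longrightarrow>
        (\<forall>i \<in> rmod_mono R A B. \<forall>g \<in> rmod_hom R A E.
           \<exists>h \<in> rmod_hom R B E. \<forall>x\<in>carrier A. h (i x) = g x))"

definition essential_mono ::
    "('a, 'r) ring_scheme \<Rightarrow> ('a, 'b, 'm) right_module_scheme \<Rightarrow>
     ('a, 'e, 'n) right_module_scheme \<Rightarrow> ('b \<Rightarrow> 'e) \<Rightarrow> bool" where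
  "essential_mono R M E \<iota> \<longleftrightarrow> \<iota> \<in> rmod_mono R M E \<and>
     (\<forall>N. right_submodule R E N \<and> N \<noteq> {\<zero>\<^bsub>E\<^esub>} \<longrightarrow> N \<inter> \<iota> ` carrier M \<noteq> {\<zero>\<^bsub>E\<^esub>})"

text \<open>
  \<open>E\<close> together with the embedding \<open>\<iota>\<close> of \<open>M\<close>, along which \<open>M\<close> is viewed as a submodule of \<open>E\<close>,
  is an injective envelope of \<open>M\<close>.
\<close>

definition injective_envelope ::
    "('a, 'r) ring_scheme \<Rightarrow> ('a, 'b, 'm) right_module_scheme \<Rightarrow>
     ('a, 'e, 'n) right_module_scheme \<Rightarrow> ('b \<Rightarrow> 'e) \<Rightarrow> bool" where
  "injective_envelope R M E \<iota> \<longleftrightarrow> injective_rmod R E \<and> essential_mono R M E \<iota>"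

text \<open>
  The type argument says in which type the elements of the injective envelope are found. The
  existence of an envelope in that type is part of the definition, so that the definition does not
  hold vacuously when the type is too small. If it holds, then \<open>M\<close> is invariant in every
  injective envelope over every type (lemma \<open>automorphism_invariant_all\<close> below). A right
  ideal of a ring with elements in \<open>'a\<close> embeds into the injective module of additive maps from
  the ring to a divisible hull of the ideal, so its envelope fits into the type
  \<open>'a \<Rightarrow> 'a \<times> nat\<close>; a statement about \<open>TYPE('e)\<close> with \<open>'e\<close> arbitrary covers this type.
\<close>

definition automorphism_invariant ::
    "'e itself \<Rightarrow> ('a, 'r) ring_scheme \<Rightarrow> ('a, 'b, 'm) right_module_scheme \<Rightarrow> bool" where
  "automorphism_invariant (_ :: 'e itself) R M \<longleftrightarrow>
     (\<exists>(E :: ('a, 'e) right_module) \<iota>. injective_envelope R M E \<iota> \<and>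
        (\<forall>\<phi> \<in> rmod_aut R E. \<phi> ` \<iota> ` carrier M \<subseteq> \<iota> ` carrier M))"


section \<open>Right a-rings\<close>

definition right_ideal :: "('a, 'r) ring_scheme \<Rightarrow> 'a set \<Rightarrow> bool" where
  "right_ideal R I \<longleftrightarrow>
     additive_subgroup I R \<and> (\<forall>x\<in>I. \<forall>a\<in>carrier R. x \<otimes>\<^bsub>R\<^esub> a \<in> I)"

definition right_ideal_module ::
    "('a, 'r) ring_scheme \<Rightarrow> 'a set \<Rightarrow> ('a, 'a) right_module" where
  "right_ideal_module R I =
     \<lparr>carrier = I, mult = mult R, one = one R, zero = zero R, add = add R, rsmult = mult R\<rparr>"

definition right_a_ring :: "'e itself \<Rightarrow> ('a, 'r) ring_scheme \<Rightarrow> bool" where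
  "right_a_ring T R \<longleftrightarrow> ring R \<and>
     (\<forall>I. right_ideal R I \<longrightarrow> automorphism_invariant T R (right_ideal_module R I))"


section \<open>Von Neumann regular and semiprime rings\<close>

definition von_neumann_regular :: "('a, 'r) ring_scheme \<Rightarrow> bool" where
  "von_neumann_regular R \<longleftrightarrow>
     (\<forall>a\<in>carrier R. \<exists>b\<in>carrier R. a = a \<otimes>\<^bsub>R\<^esub> b \<otimes>\<^bsub>R\<^esub> a)"

text \<open>The power is taken with respect to the ideal product, with \<open>I\<^sup>0\<close> the unit ideal.\<close>

definition nilpotent_ideal :: "('a, 'r) ring_scheme \<Rightarrow> 'a set \<Rightarrow> bool" where
  "nilpotent_ideal R I \<longleftrightarrow>
     ideal I R \<and> (\<exists>n::nat. I [^]\<^bsub>ideals_set R\<^esub> n = {\<zero>\<^bsub>R\<^esub>})"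

definition semiprime_ring :: "('a, 'r) ring_scheme \<Rightarrow> bool" where
  "semiprime_ring R \<longleftrightarrow> (\<forall>I. nilpotent_ideal R I \<longrightarrow> I = {\<zero>\<^bsub>R\<^esub>})"


section \<open>Independence of the types\<close>

lemma rmod_homD:
  assumes "f \<in> rmod_hom R M N"
  shows "x \<in> carrier M \<Longrightarrow> f x \<in> carrier N"
    and "\<lbrakk>x \<in> carrier M; y \<in> carrier M\<rbrakk> \<Longrightarrow> f (x \<oplus>\<^bsub>M\<^esub> y) = f x \<oplus>\<^bsub>N\<^esub> f y"
    and "\<lbrakk>x \<in> carrier M; a \<in> carrier R\<rbrakk> \<Longrightarrow> f (x \<star>\<^bsub>M\<^esub> a) = f x \<star>\<^bsub>N\<^esub> a"
  using assms by (auto simp: rmod_hom_def)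

lemma rmod_homI:
  assumes "\<And>x. x \<in> carrier M \<Longrightarrow> f x \<in> carrier N"
    and "\<And>x y. \<lbrakk>x \<in> carrier M; y \<in> carrier M\<rbrakk> \<Longrightarrow> f (x \<oplus>\<^bsub>M\<^esub> y) = f x \<oplus>\<^bsub>N\<^esub> f y"
    and "\<And>x a. \<lbrakk>x \<in> carrier M; a \<in> carrier R\<rbrakk> \<Longrightarrow> f (x \<star>\<^bsub>M\<^esub> a) = f x \<star>\<^bsub>N\<^esub> a"
  shows "f \<in> rmod_hom R M N"
  using assms by (auto simp: rmod_hom_def)

lemma rmod_hom_comp:
  assumes "f \<in> rmod_hom R M N" "g \<in> rmod_hom R N P"
  shows "(\<lambda>x. g (f x)) \<in> rmod_hom R M P"
  by (rule rmod_homI) (simp_all add: rmod_homD[OF assms(1)] rmod_homD[OF assms(2)])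

lemma rmod_hom_zero:
  assumes "right_module R M" "right_module R N" "f \<in> rmod_hom R M N"
  shows "f \<zero>\<^bsub>M\<^esub> = \<zero>\<^bsub>N\<^esub>"
proof -
  interpret M: right_module R M by fact
  interpret N: right_module R N by fact
  have "f \<zero>\<^bsub>M\<^esub> \<oplus>\<^bsub>N\<^esub> f \<zero>\<^bsub>M\<^esub> = f \<zero>\<^bsub>M\<^esub>"
    using rmod_homD(2)[OF assms(3), of "\<zero>\<^bsub>M\<^esub>" "\<zero>\<^bsub>M\<^esub>"] by simp
  moreover have "f \<zero>\<^bsub>M\<^esub> \<in> carrier N" using rmod_homD(1)[OF assms(3)] by simp
  ultimately show ?thesis by (metis N.M.add.r_cancel_one)
qed

context right_module
begin

lemma rsmult_zero_l: "a \<in> carrier R \<Longrightarrow> \<zero>\<^bsub>M\<^esub> \<star>\<^bsub>M\<^esub> a = \<zero>\<^bsub>M\<^esub>"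
  using rsmult_l_distr[of "\<zero>\<^bsub>M\<^esub>" "\<zero>\<^bsub>M\<^esub>" a]
  by (metis M.add.r_cancel_one M.l_zero M.zero_closed rsmult_closed)

lemma rsmult_zero_r: "x \<in> carrier M \<Longrightarrow> x \<star>\<^bsub>M\<^esub> \<zero>\<^bsub>R\<^esub> = \<zero>\<^bsub>M\<^esub>"
  using rsmult_r_distr[of x "\<zero>\<^bsub>R\<^esub>" "\<zero>\<^bsub>R\<^esub>"]
  by (metis M.add.r_cancel_one R.l_zero R.zero_closed rsmult_closed)

lemma rsmult_minus_r:
  assumes "x \<in> carrier M" "a \<in> carrier R"
  shows "x \<star>\<^bsub>M\<^esub> (\<ominus>\<^bsub>R\<^esub> a) = \<ominus>\<^bsub>M\<^esub> (x \<star>\<^bsub>M\<^esub> a)"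
proof -
  have "x \<star>\<^bsub>M\<^esub> (\<ominus>\<^bsub>R\<^esub> a) \<oplus>\<^bsub>M\<^esub> x \<star>\<^bsub>M\<^esub> a = \<zero>\<^bsub>M\<^esub>"
    using assms rsmult_r_distr[of x "\<ominus>\<^bsub>R\<^esub> a" a] by (simp add: R.l_neg rsmult_zero_r)
  then show ?thesis using assms by (metis M.minus_equality R.a_inv_closed rsmult_closed)
qed

lemma right_submoduleI:
  assumes "N \<subseteq> carrier M" "\<zero>\<^bsub>M\<^esub> \<in> N"
    and "\<And>x y. \<lbrakk>x \<in> N; y \<in> N\<rbrakk> \<Longrightarrow> x \<oplus>\<^bsub>M\<^esub> y \<in> N"
    and "\<And>x a. \<lbrakk>x \<in> N; a \<in> carrier R\<rbrakk> \<Longrightarrow> x \<star>\<^bsub>M\<^esub> a \<in> N"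
  shows "right_submodule R M N"
proof -
  have "\<ominus>\<^bsub>M\<^esub> x \<in> N" if "x \<in> N" for x
  proof -
    have "x \<star>\<^bsub>M\<^esub> (\<ominus>\<^bsub>R\<^esub> \<one>\<^bsub>R\<^esub>) \<in> N" using that assms(4) by simp
    moreover have "x \<star>\<^bsub>M\<^esub> (\<ominus>\<^bsub>R\<^esub> \<one>\<^bsub>R\<^esub>) = \<ominus>\<^bsub>M\<^esub> x"
      using that assms(1) by (subst rsmult_minus_r) auto
    ultimately show ?thesis by simp
  qed
  then have "subgroup N (add_monoid M)"
    using assms by (intro subgroup.intro) (auto simp: a_inv_def)
  then show ?thesis
    using assms by (simp add: right_submodule_def additive_subgroup_def)
qed

end

lemma right_ideal_rmod:
  assumes "ring R" "right_ideal R I"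
  shows "right_module R (right_ideal_module R I)"
proof -
  interpret ring R by fact
  interpret additive_subgroup I R using assms(2) by (simp add: right_ideal_def)
  have cl: "x \<otimes>\<^bsub>R\<^esub> a \<in> I" if "x \<in> I" "a \<in> carrier R" for x a
    using that assms(2) by (simp add: right_ideal_def)
  have "abelian_group (right_ideal_module R I)"
  proof (rule abelian_groupI)
    fix x assume "x \<in> carrier (right_ideal_module R I)"
    then show "\<exists>y\<in>carrier (right_ideal_module R I).
        y \<oplus>\<^bsub>right_ideal_module R I\<^esub> x = \<zero>\<^bsub>right_ideal_module R I\<^esub>"
      by (intro bexI[of _ "\<ominus>\<^bsub>R\<^esub> x"]) (auto simp: right_ideal_module_def l_neg)
  qed (auto simp: right_ideal_module_def add.m_ac)
  then show ?thesis
    by (intro right_module.intro right_module_axioms.intro assms(1))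
       (auto simp: right_ideal_module_def cl l_distr r_distr m_assoc)
qed

lemma right_ideal_carrier:
  assumes "ring R"
  shows "right_ideal R (carrier R)"
proof -
  interpret ring R by fact
  show ?thesis by (simp add: right_ideal_def additive_subgroup_def add.subgroup_self)
qed

text \<open>The graph of a partial homomorphism from \<open>B\<close> to \<open>E\<close>.\<close>

definition partial_graph where
  "partial_graph R B E S \<longleftrightarrow> S \<subseteq> carrier B \<times> carrier E \<and> (\<zero>\<^bsub>B\<^esub>, \<zero>\<^bsub>E\<^esub>) \<in> S \<and>
     (\<forall>(x, e)\<in>S. \<forall>(y, d)\<in>S. (x \<oplus>\<^bsub>B\<^esub> y, e \<oplus>\<^bsub>E\<^esub> d) \<in> S) \<and>
     (\<forall>(x, e)\<in>S. \<forall>a\<in>carrier R. (x \<star>\<^bsub>B\<^esub> a, e \<star>\<^bsub>E\<^esub> a) \<in> S) \<and>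
     (\<forall>e. (\<zero>\<^bsub>B\<^esub>, e) \<in> S \<longrightarrow> e = \<zero>\<^bsub>E\<^esub>)"

lemma partial_graph_Union:
  assumes "C \<noteq> {}" "\<And>S. S \<in> C \<Longrightarrow> partial_graph R B E S"
    and chain: "\<And>S T. \<lbrakk>S \<in> C; T \<in> C\<rbrakk> \<Longrightarrow> S \<subseteq> T \<or> T \<subseteq> S"
  shows "partial_graph R B E (\<Union>C)"
proof -
  have "(x \<oplus>\<^bsub>B\<^esub> y, e \<oplus>\<^bsub>E\<^esub> d) \<in> \<Union>C" if xy: "(x, e) \<in> \<Union>C" "(y, d) \<in> \<Union>C" for x e y d
  proof -
    obtain S T where ST: "S \<in> C" "T \<in> C" "(x, e) \<in> S" "(y, d) \<in> T" using xy by blast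
    then obtain U where "U \<in> C" "(x, e) \<in> U" "(y, d) \<in> U" using chain by blast
    then show ?thesis using assms(2)[of U] unfolding partial_graph_def by blast
  qed
  moreover have "\<Union>C \<subseteq> carrier B \<times> carrier E" "(\<zero>\<^bsub>B\<^esub>, \<zero>\<^bsub>E\<^esub>) \<in> \<Union>C"
      "\<forall>e. (\<zero>\<^bsub>B\<^esub>, e) \<in> \<Union>C \<longrightarrow> e = \<zero>\<^bsub>E\<^esub>"
      "\<forall>(x, e)\<in>\<Union>C. \<forall>a\<in>carrier R. (x \<star>\<^bsub>B\<^esub> a, e \<star>\<^bsub>E\<^esub> a) \<in> \<Union>C"
    using assms(1,2) unfolding partial_graph_def by blast+
  ultimately show ?thesis unfolding partial_graph_def by blast
qed

lemma partial_graph_unique: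
  assumes "right_module R B" "right_module R E" and S: "partial_graph R B E S"
    and xe: "(x, e) \<in> S" and xd: "(x, d) \<in> S"
  shows "e = d"
proof -
  interpret B: right_module R B by fact
  interpret E: right_module R E by fact
  have c: "x \<in> carrier B" "e \<in> carrier E" "d \<in> carrier E"
    using S xe xd by (auto simp: partial_graph_def)
  have "(x \<star>\<^bsub>B\<^esub> (\<ominus>\<^bsub>R\<^esub> \<one>\<^bsub>R\<^esub>), d \<star>\<^bsub>E\<^esub> (\<ominus>\<^bsub>R\<^esub> \<one>\<^bsub>R\<^esub>)) \<in> S"
    using S xd B.R.a_inv_closed[OF B.R.one_closed] unfolding partial_graph_def by blast
  then have "(\<ominus>\<^bsub>B\<^esub> x, \<ominus>\<^bsub>E\<^esub> d) \<in> S"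
    using c by (simp add: B.rsmult_minus_r E.rsmult_minus_r)
  then have "(x \<oplus>\<^bsub>B\<^esub> \<ominus>\<^bsub>B\<^esub> x, e \<oplus>\<^bsub>E\<^esub> \<ominus>\<^bsub>E\<^esub> d) \<in> S"
    using S xe unfolding partial_graph_def by blast
  then have "e \<oplus>\<^bsub>E\<^esub> \<ominus>\<^bsub>E\<^esub> d = \<zero>\<^bsub>E\<^esub>"
    using S c by (simp add: B.M.r_neg partial_graph_def)
  then show ?thesis using c
    by (metis E.M.minus_equality E.M.minus_minus E.M.a_inv_closed)
qed

lemma injective_extend:
  fixes E :: "('a, 'e, 'm) right_module_scheme"
    and A :: "('a, 'x, 'k) right_module_scheme" and B :: "('a, 'y, 'l) right_module_scheme"
  assumes inj: "injective_rmod R E" and A: "right_module R A" and B: "right_module R B"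
    and i: "i \<in> rmod_mono R A B" and g: "g \<in> rmod_hom R A E"
  shows "\<exists>h \<in> rmod_hom R B E. \<forall>x\<in>carrier A. h (i x) = g x"
proof -
  have E: "right_module R E" using inj by (simp add: injective_rmod_def)
  interpret A: right_module R A by fact
  interpret B: right_module R B by fact
  interpret E: right_module R E by fact
  have ih: "i \<in> rmod_hom R A B" and iinj: "inj_on i (carrier A)"
    using i by (auto simp: rmod_mono_def)
  define S0 where "S0 = (\<lambda>x. (i x, g x)) ` carrier A"
  have i0: "i \<zero>\<^bsub>A\<^esub> = \<zero>\<^bsub>B\<^esub>" by (rule rmod_hom_zero[OF A B ih])
  have g0: "g \<zero>\<^bsub>A\<^esub> = \<zero>\<^bsub>E\<^esub>" by (rule rmod_hom_zero[OF A E g])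
  have S0I: "(i u, g u) \<in> S0" if "u \<in> carrier A" for u using that by (auto simp: S0_def)
  have S0: "partial_graph R B E S0"
  proof -
    have "S0 \<subseteq> carrier B \<times> carrier E"
      using rmod_homD(1)[OF ih] rmod_homD(1)[OF g] by (auto simp: S0_def)
    moreover have "(\<zero>\<^bsub>B\<^esub>, \<zero>\<^bsub>E\<^esub>) \<in> S0"
      unfolding S0_def by (rule image_eqI[of _ _ "\<zero>\<^bsub>A\<^esub>"]) (simp_all add: i0 g0)
    moreover have "(x \<oplus>\<^bsub>B\<^esub> y, e \<oplus>\<^bsub>E\<^esub> d) \<in> S0" if p: "(x, e) \<in> S0" "(y, d) \<in> S0" for x e y d
    proof -
      obtain u where u: "u \<in> carrier A" "x = i u" "e = g u" using p(1) by (auto simp: S0_def)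
      obtain v where v: "v \<in> carrier A" "y = i v" "d = g v" using p(2) by (auto simp: S0_def)
      have "(x \<oplus>\<^bsub>B\<^esub> y, e \<oplus>\<^bsub>E\<^esub> d) = (i (u \<oplus>\<^bsub>A\<^esub> v), g (u \<oplus>\<^bsub>A\<^esub> v))"
        using u v by (simp add: rmod_homD(2)[OF ih] rmod_homD(2)[OF g])
      then show ?thesis using S0I[of "u \<oplus>\<^bsub>A\<^esub> v"] u(1) v(1) by simp
    qed
    moreover have "(x \<star>\<^bsub>B\<^esub> a, e \<star>\<^bsub>E\<^esub> a) \<in> S0" if p: "(x, e) \<in> S0" "a \<in> carrier R" for x e a
    proof -
      obtain u where u: "u \<in> carrier A" "x = i u" "e = g u" using p(1) by (auto simp: S0_def)
      have "(x \<star>\<^bsub>B\<^esub> a, e \<star>\<^bsub>E\<^esub> a) = (i (u \<star>\<^bsub>A\<^esub> a), g (u \<star>\<^bsub>A\<^esub> a))"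
        using u p(2) by (simp add: rmod_homD(3)[OF ih] rmod_homD(3)[OF g])
      then show ?thesis using S0I[of "u \<star>\<^bsub>A\<^esub> a"] u(1) p(2) by simp
    qed
    moreover have "e = \<zero>\<^bsub>E\<^esub>" if p: "(\<zero>\<^bsub>B\<^esub>, e) \<in> S0" for e
    proof -
      obtain u where u: "u \<in> carrier A" "\<zero>\<^bsub>B\<^esub> = i u" "e = g u"
        using p by (auto simp: S0_def)
      then have "u = \<zero>\<^bsub>A\<^esub>" using iinj i0 by (metis A.M.zero_closed inj_onD)
      then show ?thesis using u g0 by simp
    qed
    ultimately show ?thesis unfolding partial_graph_def by blast
  qed
  define F where "F = {S. partial_graph R B E S \<and> S0 \<subseteq> S}"
  have "\<exists>S\<in>F. \<forall>T\<in>F. S \<subseteq> T \<longrightarrow> T = S"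
  proof (rule subset_Zorn_nonempty)
    show "F \<noteq> {}" using S0 by (auto simp: F_def)
    fix C assume C: "C \<noteq> {}" "subset.chain F C"
    then have "C \<subseteq> F" by (simp add: subset.chain_def)
    moreover have "partial_graph R B E (\<Union>C)"
    proof (rule partial_graph_Union[OF C(1)])
      show "partial_graph R B E S" if "S \<in> C" for S using that \<open>C \<subseteq> F\<close> by (auto simp: F_def)
      show "S \<subseteq> T \<or> T \<subseteq> S" if "S \<in> C" "T \<in> C" for S T
        using C(2) that unfolding subset_chain_def by blast
    qed
    ultimately show "\<Union>C \<in> F" using C(1) by (auto simp: F_def)
  qed
  then obtain S where SF: "S \<in> F" and max: "\<And>T. \<lbrakk>T \<in> F; S \<subseteq> T\<rbrakk> \<Longrightarrow> T = S" by blast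
  have S: "partial_graph R B E S" "S0 \<subseteq> S" using SF by (auto simp: F_def)
  have Sc: "x \<in> carrier B" "e \<in> carrier E" if "(x, e) \<in> S" for x e
    using S(1) that unfolding partial_graph_def by blast+
  have Sz: "(\<zero>\<^bsub>B\<^esub>, \<zero>\<^bsub>E\<^esub>) \<in> S" using S(1) unfolding partial_graph_def by blast
  have Sa: "(x \<oplus>\<^bsub>B\<^esub> y, e \<oplus>\<^bsub>E\<^esub> d) \<in> S" if "(x, e) \<in> S" "(y, d) \<in> S" for x e y d
    using S(1) that unfolding partial_graph_def by blast
  have Sm: "(x \<star>\<^bsub>B\<^esub> a, e \<star>\<^bsub>E\<^esub> a) \<in> S" if "(x, e) \<in> S" "a \<in> carrier R" for x e a
    using S(1) that unfolding partial_graph_def by blast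
  note Su = partial_graph_unique[OF B E S(1)]
  have total: "\<exists>e. (b, e) \<in> S" if b: "b \<in> carrier B" for b
  proof -
    define I where "I = {r \<in> carrier R. \<exists>e. (b \<star>\<^bsub>B\<^esub> r, e) \<in> S}"
    define k where "k r = (THE e. (b \<star>\<^bsub>B\<^esub> r, e) \<in> S)" for r
    have kI: "k r = e" if "(b \<star>\<^bsub>B\<^esub> r, e) \<in> S" for r e
      unfolding k_def by (rule the_equality) (rule that, rule Su, assumption, rule that)
    have kS: "(b \<star>\<^bsub>B\<^esub> r, k r) \<in> S" if r: "r \<in> I" for r
    proof -
      obtain e where e: "(b \<star>\<^bsub>B\<^esub> r, e) \<in> S" using r by (auto simp: I_def)
      show ?thesis using e kI[OF e] by simp
    qed
    have Ic: "r \<in> carrier R" if "r \<in> I" for r using that by (simp add: I_def)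
    have addS: "(b \<star>\<^bsub>B\<^esub> (r \<oplus>\<^bsub>R\<^esub> s), k r \<oplus>\<^bsub>E\<^esub> k s) \<in> S" if "r \<in> I" "s \<in> I" for r s
      using Sa[OF kS[OF that(1)] kS[OF that(2)]] Ic[OF that(1)] Ic[OF that(2)] b by (simp add: B.rsmult_r_distr)
    have mulS: "(b \<star>\<^bsub>B\<^esub> (r \<otimes>\<^bsub>R\<^esub> a), k r \<star>\<^bsub>E\<^esub> a) \<in> S" if "r \<in> I" "a \<in> carrier R" for r a
      using Sm[OF kS[OF that(1)] that(2)] Ic[OF that(1)] that(2) b by (simp add: B.rsmult_assoc)
    have mulI: "r \<otimes>\<^bsub>R\<^esub> a \<in> I" if "r \<in> I" "a \<in> carrier R" for r a
      using mulS[OF that] Ic[OF that(1)] that(2) by (auto simp: I_def)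
    have "subgroup I (add_monoid R)"
    proof (rule subgroup.intro)
      show "\<one>\<^bsub>add_monoid R\<^esub> \<in> I" using Sz b by (auto simp: I_def B.rsmult_zero_r)
      fix x assume x: "x \<in> I"
      have "x \<otimes>\<^bsub>R\<^esub> (\<ominus>\<^bsub>R\<^esub> \<one>\<^bsub>R\<^esub>) \<in> I" using mulI[OF x] by simp
      then have "\<ominus>\<^bsub>R\<^esub> x \<in> I" using Ic[OF x] by (simp add: A.R.r_minus)
      then show "inv\<^bsub>add_monoid R\<^esub> x \<in> I" by (simp add: a_inv_def)
      show "x \<otimes>\<^bsub>add_monoid R\<^esub> y \<in> I" if "y \<in> I" for y
        using addS[OF x that] Ic[OF x] Ic[OF that] by (auto simp: I_def)
    qed (auto simp: I_def)
    then have I: "right_ideal R I"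
      using mulI by (simp add: right_ideal_def additive_subgroup_def)
    let ?I = "right_ideal_module R I" and ?R = "right_ideal_module R (carrier R)"
    have "(\<lambda>x. x) \<in> rmod_mono R ?I ?R"
      using Ic by (auto simp: rmod_mono_def rmod_hom_def right_ideal_module_def)
    moreover have "k \<in> rmod_hom R ?I E"
    proof (rule rmod_homI)
      show "k x \<in> carrier E" if "x \<in> carrier ?I" for x
        using Sc(2)[OF kS] that by (simp add: right_ideal_module_def)
      show "k (x \<oplus>\<^bsub>?I\<^esub> y) = k x \<oplus>\<^bsub>E\<^esub> k y" if "x \<in> carrier ?I" "y \<in> carrier ?I" for x y
        using kI[OF addS] that by (simp add: right_ideal_module_def)
      show "k (x \<star>\<^bsub>?I\<^esub> a) = k x \<star>\<^bsub>E\<^esub> a" if "x \<in> carrier ?I" "a \<in> carrier R" for x a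
        using kI[OF mulS] that by (simp add: right_ideal_module_def)
    qed
    moreover have "right_module R ?I" "right_module R ?R"
      using I A.R.ring_axioms right_ideal_rmod right_ideal_carrier by blast+
    ultimately obtain h where h: "h \<in> rmod_hom R ?R E" "\<forall>x\<in>carrier ?I. h x = k x"
      using inj[unfolded injective_rmod_def, THEN conjunct2, rule_format, of ?I ?R "\<lambda>x. x" k]
      by blast
    define e0 where "e0 = h \<one>\<^bsub>R\<^esub>"
    have e0: "e0 \<in> carrier E"
      using rmod_homD(1)[OF h(1)] by (simp add: e0_def right_ideal_module_def)
    have ke0: "k r = e0 \<star>\<^bsub>E\<^esub> r" if "r \<in> I" for r
      using rmod_homD(3)[OF h(1), of "\<one>\<^bsub>R\<^esub>" r] h(2) that Ic[OF that]
      by (simp add: e0_def right_ideal_module_def)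
    define T where "T = {(x \<oplus>\<^bsub>B\<^esub> b \<star>\<^bsub>B\<^esub> r, e \<oplus>\<^bsub>E\<^esub> e0 \<star>\<^bsub>E\<^esub> r) | x e r. (x, e) \<in> S \<and> r \<in> carrier R}"
    have TI: "(x \<oplus>\<^bsub>B\<^esub> b \<star>\<^bsub>B\<^esub> r, e \<oplus>\<^bsub>E\<^esub> e0 \<star>\<^bsub>E\<^esub> r) \<in> T" if "(x, e) \<in> S" "r \<in> carrier R" for x e r
      using that unfolding T_def by blast
    have ST: "S \<subseteq> T"
    proof
      fix p assume "p \<in> S"
      then obtain x e where p: "p = (x, e)" "(x, e) \<in> S" by (cases p) auto
      then show "p \<in> T"
        using TI[OF p(2) A.R.zero_closed] Sc[OF p(2)] b e0
        by (simp add: B.rsmult_zero_r E.rsmult_zero_r)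
    qed
    have "partial_graph R B E T"
      unfolding partial_graph_def
    proof (intro conjI)
      show "T \<subseteq> carrier B \<times> carrier E" using Sc b e0 by (auto simp: T_def)
      show "(\<zero>\<^bsub>B\<^esub>, \<zero>\<^bsub>E\<^esub>) \<in> T" using ST Sz by blast
      have "(x \<oplus>\<^bsub>B\<^esub> y, e \<oplus>\<^bsub>E\<^esub> d) \<in> T" if "(x, e) \<in> T" "(y, d) \<in> T" for x e y d
      proof -
        obtain x' e' r where 1: "x = x' \<oplus>\<^bsub>B\<^esub> b \<star>\<^bsub>B\<^esub> r" "e = e' \<oplus>\<^bsub>E\<^esub> e0 \<star>\<^bsub>E\<^esub> r"
            "(x', e') \<in> S" "r \<in> carrier R" using \<open>(x, e) \<in> T\<close> by (auto simp: T_def)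
        obtain y' d' s where 2: "y = y' \<oplus>\<^bsub>B\<^esub> b \<star>\<^bsub>B\<^esub> s" "d = d' \<oplus>\<^bsub>E\<^esub> e0 \<star>\<^bsub>E\<^esub> s"
            "(y', d') \<in> S" "s \<in> carrier R" using \<open>(y, d) \<in> T\<close> by (auto simp: T_def)
        have "x \<oplus>\<^bsub>B\<^esub> y = (x' \<oplus>\<^bsub>B\<^esub> y') \<oplus>\<^bsub>B\<^esub> b \<star>\<^bsub>B\<^esub> (r \<oplus>\<^bsub>R\<^esub> s)"
          using 1 2 Sc b by (simp add: B.rsmult_r_distr B.M.add.m_ac)
        moreover have "e \<oplus>\<^bsub>E\<^esub> d = (e' \<oplus>\<^bsub>E\<^esub> d') \<oplus>\<^bsub>E\<^esub> e0 \<star>\<^bsub>E\<^esub> (r \<oplus>\<^bsub>R\<^esub> s)"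
          using 1 2 Sc e0 by (simp add: E.rsmult_r_distr E.M.add.m_ac)
        ultimately show ?thesis
          using TI[OF Sa[OF 1(3) 2(3)], of "r \<oplus>\<^bsub>R\<^esub> s"] 1(4) 2(4) by simp
      qed
      then show "\<forall>(x, e)\<in>T. \<forall>(y, d)\<in>T. (x \<oplus>\<^bsub>B\<^esub> y, e \<oplus>\<^bsub>E\<^esub> d) \<in> T" by blast
      have "(x \<star>\<^bsub>B\<^esub> a, e \<star>\<^bsub>E\<^esub> a) \<in> T" if "(x, e) \<in> T" "a \<in> carrier R" for x e a
      proof -
        obtain x' e' r where 1: "x = x' \<oplus>\<^bsub>B\<^esub> b \<star>\<^bsub>B\<^esub> r" "e = e' \<oplus>\<^bsub>E\<^esub> e0 \<star>\<^bsub>E\<^esub> r"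
            "(x', e') \<in> S" "r \<in> carrier R" using \<open>(x, e) \<in> T\<close> by (auto simp: T_def)
        have "x \<star>\<^bsub>B\<^esub> a = x' \<star>\<^bsub>B\<^esub> a \<oplus>\<^bsub>B\<^esub> b \<star>\<^bsub>B\<^esub> (r \<otimes>\<^bsub>R\<^esub> a)"
          using 1 that(2) Sc b by (simp add: B.rsmult_l_distr B.rsmult_assoc)
        moreover have "e \<star>\<^bsub>E\<^esub> a = e' \<star>\<^bsub>E\<^esub> a \<oplus>\<^bsub>E\<^esub> e0 \<star>\<^bsub>E\<^esub> (r \<otimes>\<^bsub>R\<^esub> a)"
          using 1 that(2) Sc e0 by (simp add: E.rsmult_l_distr E.rsmult_assoc)
        ultimately show ?thesis
          using TI[OF Sm[OF 1(3) that(2)], of "r \<otimes>\<^bsub>R\<^esub> a"] 1(4) that(2) by simp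
      qed
      then show "\<forall>(x, e)\<in>T. \<forall>a\<in>carrier R. (x \<star>\<^bsub>B\<^esub> a, e \<star>\<^bsub>E\<^esub> a) \<in> T" by blast
      show "\<forall>e. (\<zero>\<^bsub>B\<^esub>, e) \<in> T \<longrightarrow> e = \<zero>\<^bsub>E\<^esub>"
      proof (intro allI impI)
        fix e assume "(\<zero>\<^bsub>B\<^esub>, e) \<in> T"
        then obtain x' e' r where 1: "\<zero>\<^bsub>B\<^esub> = x' \<oplus>\<^bsub>B\<^esub> b \<star>\<^bsub>B\<^esub> r" "e = e' \<oplus>\<^bsub>E\<^esub> e0 \<star>\<^bsub>E\<^esub> r"
            "(x', e') \<in> S" "r \<in> carrier R" by (auto simp: T_def)
        have m1: "\<ominus>\<^bsub>R\<^esub> \<one>\<^bsub>R\<^esub> \<in> carrier R" by simp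
        have "(\<ominus>\<^bsub>B\<^esub> x', \<ominus>\<^bsub>E\<^esub> e') \<in> S"
          using Sm[OF 1(3) m1] Sc[OF 1(3)] by (simp add: B.rsmult_minus_r E.rsmult_minus_r)
        moreover have "\<ominus>\<^bsub>B\<^esub> x' = b \<star>\<^bsub>B\<^esub> r"
          using 1(1,4) Sc[OF 1(3)] b
          by (metis B.M.a_comm B.M.minus_equality B.rsmult_closed)
        ultimately have s: "(b \<star>\<^bsub>B\<^esub> r, \<ominus>\<^bsub>E\<^esub> e') \<in> S" by simp
        then have "r \<in> I" using 1(4) by (auto simp: I_def)
        then have "e0 \<star>\<^bsub>E\<^esub> r = \<ominus>\<^bsub>E\<^esub> e'" using kI[OF s] ke0 by simp
        then show "e = \<zero>\<^bsub>E\<^esub>" using 1(2) Sc[OF 1(3)] by (simp add: E.M.r_neg)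
      qed
    qed
    then have "T = S" using max[of T] ST S(2) by (auto simp: F_def)
    moreover have "(b, e0) \<in> T"
      using TI[OF Sz A.R.one_closed] b e0 by simp
    ultimately show ?thesis by blast
  qed
  define h where "h b = (THE e. (b, e) \<in> S)" for b
  have hI: "h b = e" if "(b, e) \<in> S" for b e
    unfolding h_def by (rule the_equality) (rule that, rule Su, assumption, rule that)
  have hS: "(b, h b) \<in> S" if b: "b \<in> carrier B" for b
  proof -
    obtain e where e: "(b, e) \<in> S" using total[OF b] by blast
    show ?thesis using e hI[OF e] by simp
  qed
  have "h \<in> rmod_hom R B E"
  proof (rule rmod_homI)
    show "h x \<in> carrier E" if "x \<in> carrier B" for x using Sc(2)[OF hS[OF that]] .
    show "h (x \<oplus>\<^bsub>B\<^esub> y) = h x \<oplus>\<^bsub>E\<^esub> h y" if "x \<in> carrier B" "y \<in> carrier B" for x y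
      by (rule hI[OF Sa[OF hS[OF that(1)] hS[OF that(2)]]])
    show "h (x \<star>\<^bsub>B\<^esub> a) = h x \<star>\<^bsub>E\<^esub> a" if "x \<in> carrier B" "a \<in> carrier R" for x a
      by (rule hI[OF Sm[OF hS[OF that(1)] that(2)]])
  qed
  moreover have "h (i x) = g x" if "x \<in> carrier A" for x
    using S(2) that by (intro hI) (auto simp: S0_def)
  ultimately show ?thesis by blast
qed

lemma essential_hom_inj:
  assumes M: "right_module R M" and E: "right_module R E" and N: "right_module R N"
    and ess: "essential_mono R M E \<iota>"
    and f: "f \<in> rmod_hom R E N" and inj: "inj_on (\<lambda>x. f (\<iota> x)) (carrier M)"
  shows "inj_on f (carrier E)"
proof -
  interpret M: right_module R M by fact
  interpret E: right_module R E by fact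
  interpret N: right_module R N by fact
  have \<iota>: "\<iota> \<in> rmod_hom R M E" using ess by (simp add: essential_mono_def rmod_mono_def)
  have \<iota>0: "\<iota> \<zero>\<^bsub>M\<^esub> = \<zero>\<^bsub>E\<^esub>" by (rule rmod_hom_zero[OF M E \<iota>])
  have f0: "f \<zero>\<^bsub>E\<^esub> = \<zero>\<^bsub>N\<^esub>" by (rule rmod_hom_zero[OF E N f])
  define K where "K = {x \<in> carrier E. f x = \<zero>\<^bsub>N\<^esub>}"
  have "right_submodule R E K"
    by (rule E.right_submoduleI) (auto simp: K_def f0 rmod_homD[OF f] N.rsmult_zero_l)
  moreover have "K \<inter> \<iota> ` carrier M = {\<zero>\<^bsub>E\<^esub>}"
  proof
    show "K \<inter> \<iota> ` carrier M \<subseteq> {\<zero>\<^bsub>E\<^esub>}"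
    proof
      fix z assume "z \<in> K \<inter> \<iota> ` carrier M"
      then obtain x where x: "x \<in> carrier M" "z = \<iota> x" "f (\<iota> x) = \<zero>\<^bsub>N\<^esub>" by (auto simp: K_def)
      then have "x = \<zero>\<^bsub>M\<^esub>" using inj_onD[OF inj, of x "\<zero>\<^bsub>M\<^esub>"] \<iota>0 f0 by simp
      then show "z \<in> {\<zero>\<^bsub>E\<^esub>}" using x \<iota>0 by simp
    qed
    show "{\<zero>\<^bsub>E\<^esub>} \<subseteq> K \<inter> \<iota> ` carrier M"
      using \<iota>0 f0 by (auto simp: K_def intro!: image_eqI[of _ _ "\<zero>\<^bsub>M\<^esub>"])
  qed
  ultimately have K: "K = {\<zero>\<^bsub>E\<^esub>}" using ess unfolding essential_mono_def by blast
  show ?thesis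
  proof (rule inj_onI)
    fix x y assume xy: "x \<in> carrier E" "y \<in> carrier E" "f x = f y"
    let ?m = "y \<star>\<^bsub>E\<^esub> (\<ominus>\<^bsub>R\<^esub> \<one>\<^bsub>R\<^esub>)"
    have m: "?m = \<ominus>\<^bsub>E\<^esub> y" using xy by (simp add: E.rsmult_minus_r)
    have "f (x \<oplus>\<^bsub>E\<^esub> ?m) = f x \<oplus>\<^bsub>N\<^esub> f y \<star>\<^bsub>N\<^esub> (\<ominus>\<^bsub>R\<^esub> \<one>\<^bsub>R\<^esub>)"
      using xy by (simp add: rmod_homD[OF f])
    also have "\<dots> = \<zero>\<^bsub>N\<^esub>"
      using xy rmod_homD(1)[OF f, of y] by (simp add: N.rsmult_minus_r N.M.r_neg)
    finally have "x \<oplus>\<^bsub>E\<^esub> ?m \<in> K" using xy by (simp add: K_def)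
    then have "x \<oplus>\<^bsub>E\<^esub> \<ominus>\<^bsub>E\<^esub> y = \<zero>\<^bsub>E\<^esub>" using K m by simp
    then show "x = y" using xy
      by (metis E.M.minus_equality E.M.minus_minus E.M.a_inv_closed)
  qed
qed

lemma injective_envelope_unique:
  assumes M: "right_module R M"
    and E: "injective_envelope R M E \<iota>" and F: "injective_envelope R M F \<kappa>"
  obtains f h where "f \<in> rmod_hom R E F" "h \<in> rmod_hom R F E"
    "\<And>x. x \<in> carrier E \<Longrightarrow> h (f x) = x" "\<And>y. y \<in> carrier F \<Longrightarrow> f (h y) = y"
    "\<And>x. x \<in> carrier M \<Longrightarrow> f (\<iota> x) = \<kappa> x" "\<And>x. x \<in> carrier M \<Longrightarrow> h (\<kappa> x) = \<iota> x"
proof -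
  have Em: "right_module R E" "injective_rmod R E" "essential_mono R M E \<iota>"
    and Fm: "right_module R F" "injective_rmod R F" "essential_mono R M F \<kappa>"
    using E F by (auto simp: injective_envelope_def injective_rmod_def)
  have \<iota>: "\<iota> \<in> rmod_mono R M E" and \<kappa>: "\<kappa> \<in> rmod_mono R M F"
    using Em Fm by (auto simp: essential_mono_def)
  then have \<iota>h: "\<iota> \<in> rmod_hom R M E" "inj_on \<iota> (carrier M)"
    and \<kappa>h: "\<kappa> \<in> rmod_hom R M F" "inj_on \<kappa> (carrier M)"
    by (auto simp: rmod_mono_def)
  obtain f where f: "f \<in> rmod_hom R E F" "\<forall>x\<in>carrier M. f (\<iota> x) = \<kappa> x"
    using injective_extend[OF Fm(2) M Em(1) \<iota> \<kappa>h(1)] by blast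
  have "inj_on (\<lambda>x. f (\<iota> x)) (carrier M)" using \<kappa>h(2) f(2) by (simp add: inj_on_def)
  then have finj: "inj_on f (carrier E)"
    by (rule essential_hom_inj[OF M Em(1) Fm(1) Em(3) f(1)])
  then have "f \<in> rmod_mono R E F" using f(1) by (simp add: rmod_mono_def)
  moreover have "(\<lambda>x. x) \<in> rmod_hom R E E" by (simp add: rmod_hom_def)
  ultimately obtain h where h: "h \<in> rmod_hom R F E" "\<forall>x\<in>carrier E. h (f x) = x"
    using injective_extend[OF Em(2) Em(1) Fm(1), of f "\<lambda>x. x"] by blast
  have h\<kappa>: "h (\<kappa> x) = \<iota> x" if "x \<in> carrier M" for x
    using f(2) h(2) rmod_homD(1)[OF \<iota>h(1) that] that by metis
  have "inj_on (\<lambda>x. h (\<kappa> x)) (carrier M)" using \<iota>h(2) h\<kappa> by (simp add: inj_on_def)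
  then have hinj: "inj_on h (carrier F)"
    by (rule essential_hom_inj[OF M Fm(1) Em(1) Fm(3) h(1)])
  have fh: "f (h y) = y" if y: "y \<in> carrier F" for y
  proof (rule inj_onD[OF hinj _ _ y])
    have hy: "h y \<in> carrier E" by (rule rmod_homD(1)[OF h(1) y])
    then show "h (f (h y)) = h y" using h(2) by blast
    show "f (h y) \<in> carrier F" by (rule rmod_homD(1)[OF f(1) hy])
  qed
  show ?thesis by (rule that[OF f(1) h(1)]) (simp_all add: h(2) f(2) fh h\<kappa>)
qed

lemma automorphism_invariant_all:
  assumes M: "right_module R M"
    and inv: "automorphism_invariant TYPE('e) R M"
    and F: "injective_envelope R M F \<kappa>" and \<phi>: "\<phi> \<in> rmod_aut R F"
  shows "\<phi> ` \<kappa> ` carrier M \<subseteq> \<kappa> ` carrier M"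
proof -
  obtain E :: "('a, 'e) right_module" and \<iota> where E: "injective_envelope R M E \<iota>"
    and invE: "\<forall>\<psi> \<in> rmod_aut R E. \<psi> ` \<iota> ` carrier M \<subseteq> \<iota> ` carrier M"
    using inv unfolding automorphism_invariant_def by (elim exE conjE)
  obtain f h where f: "f \<in> rmod_hom R E F" and h: "h \<in> rmod_hom R F E"
    and hf: "\<And>x. x \<in> carrier E \<Longrightarrow> h (f x) = x" and fh: "\<And>y. y \<in> carrier F \<Longrightarrow> f (h y) = y"
    and f\<iota>: "\<And>x. x \<in> carrier M \<Longrightarrow> f (\<iota> x) = \<kappa> x"
    and "\<And>x. x \<in> carrier M \<Longrightarrow> h (\<kappa> x) = \<iota> x"
    by (rule injective_envelope_unique[OF M E F]) (rule that)
  have \<kappa>: "\<kappa> \<in> rmod_hom R M F"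
    using F by (simp add: injective_envelope_def essential_mono_def rmod_mono_def)
  have \<phi>h: "\<phi> \<in> rmod_hom R F F" and \<phi>b: "bij_betw \<phi> (carrier F) (carrier F)"
    using \<phi> by (auto simp: rmod_aut_def)
  define \<psi> where "\<psi> = (\<lambda>x. h (\<phi> (f x)))"
  have fc: "f ` carrier E \<subseteq> carrier F" and hc: "h ` carrier F \<subseteq> carrier E"
    using rmod_homD(1)[OF f] rmod_homD(1)[OF h] by auto
  have bf: "bij_betw f (carrier E) (carrier F)"
    by (rule bij_betw_byWitness[OF _ _ fc hc]) (simp_all add: hf fh)
  have bh: "bij_betw h (carrier F) (carrier E)"
    by (rule bij_betw_byWitness[OF _ _ hc fc]) (simp_all add: hf fh)
  have "bij_betw \<psi> (carrier E) (carrier E)"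
    using bij_betw_trans[OF bij_betw_trans[OF bf \<phi>b] bh] by (simp add: \<psi>_def o_def)
  moreover have "\<psi> \<in> rmod_hom R E E"
    unfolding \<psi>_def by (rule rmod_hom_comp[OF rmod_hom_comp[OF f \<phi>h] h])
  ultimately have \<psi>: "\<psi> ` \<iota> ` carrier M \<subseteq> \<iota> ` carrier M"
    by (intro bspec[OF invE]) (simp add: rmod_aut_def)
  show ?thesis
  proof
    fix z assume "z \<in> \<phi> ` \<kappa> ` carrier M"
    then obtain x where x: "x \<in> carrier M" "z = \<phi> (\<kappa> x)" by blast
    obtain y where y: "y \<in> carrier M" "\<psi> (\<iota> x) = \<iota> y" using \<psi> x(1) by blast
    have zc: "z \<in> carrier F" using x rmod_homD(1)[OF \<phi>h] rmod_homD(1)[OF \<kappa>] by simp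
    have "h z = \<iota> y" using y x f\<iota> by (simp add: \<psi>_def)
    then have "z = \<kappa> y" using fh[OF zc] f\<iota>[OF y(1)] by simp
    then show "z \<in> \<kappa> ` carrier M" using y(1) by simp
  qed
qed

end

theory Submission
  imports Defs
begin

text \<open>
  A regular ring has no nonzero nilpotent ideal \<open>I\<close>, because \<open>a = a(ba)\<close> puts \<open>a \<in> I\<close> into every
  power of \<open>I\<close>. The converse is the substance.

  Injective envelopes enter through one fact only (\<open>a_ring_extend_partial_iso\<close>). Let \<open>\<theta>\<close> be an
  isomorphism between two essential right ideals of a right a-ring. It extends to an automorphism of
  \<open>E(R)\<close>, and \<open>R\<close> is invariant under it, so \<open>\<theta>\<close> is left multiplication by some \<open>u \<in> R\<close>. Since
  \<open>E(R) = E(I)\<close> for each essential right ideal \<open>I\<close>, also \<open>uI \<subseteq> I\<close>. From here on everything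
  happens inside \<open>R\<close>; a ring with this extension property is called rigid below.

  Semiprime implies right nonsingular (\<open>semiprime_nonsingular\<close>). If the annihilator of \<open>w\<close> is
  essential, then \<open>1 + w\<close> is such a \<open>u\<close>, so \<open>wI \<subseteq> I\<close> for all essential \<open>I\<close>. Taking for
  \<open>I\<close> the annihilator of a singular \<open>w \<noteq> 0\<close> yields \<open>wZa = 0\<close> for the singular ideal \<open>Z\<close> and
  some \<open>0 \<noteq> a = ws \<in> I\<close>, and \<open>a\<close> then generates a nilpotent ideal.

  In the nonsingular case, let \<open>X\<close> and \<open>Y\<close> be isomorphic right ideals with \<open>X \<inter> Y = 0\<close>. The
  square-zero maps \<open>X \<rightarrow> Y\<close> and \<open>Y \<rightarrow> X\<close> are left multiplications that preserve essential
  right ideals, and this forces \<open>X\<close> to be generated by an idempotent (\<open>repeated_right_ideal\<close>). Choose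
  such a pair maximal and let \<open>g\<close> be an idempotent with \<open>gR = X + Y\<close>. Every right ideal inside
  \<open>gR\<close> is generated by an idempotent (\<open>repeated_submodule_summand\<close>). Since \<open>a\<close> is regular
  as soon as some \<open>a - ata\<close> is, this permits replacing \<open>a\<close> by an element with \<open>ga = 0\<close> and
  then also \<open>ag = 0\<close>. For such \<open>a\<close>, choose \<open>C \<subseteq> (1 - g)R\<close> with \<open>C \<oplus> ker a\<close>
  essential. By maximality of the pair, no nonzero right ideal \<open>D \<subseteq> C\<close> satisfies
  \<open>D \<inter> aD = 0\<close>, and it follows that \<open>c + k \<mapsto> ac + k\<close> is an isomorphism of
  \<open>C \<oplus> ker a\<close> onto an essential right ideal. Its inverse is left multiplication by some
  \<open>v \<in> R\<close>, and \<open>ava = a\<close>.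
\<close>

(* The symbol is used for the sum of right ideals. *)
no_notation Sum_Type.Plus (infixr \<open><+>\<close> 65)

section \<open>Essential right ideals and isomorphisms between right ideals\<close>

definition essential_right_ideal :: "('a, 'r) ring_scheme \<Rightarrow> 'a set \<Rightarrow> bool" where
  "essential_right_ideal R I \<longleftrightarrow> right_ideal R I \<and>
     (\<forall>x\<in>carrier R. x \<noteq> \<zero>\<^bsub>R\<^esub> \<longrightarrow> (\<exists>r\<in>carrier R. x \<otimes>\<^bsub>R\<^esub> r \<in> I \<and> x \<otimes>\<^bsub>R\<^esub> r \<noteq> \<zero>\<^bsub>R\<^esub>))"

text \<open>
  The graph of an isomorphism between two right ideals, namely the domain and the range of the
  relation. In relational form the inverse is the converse, and the union of a chain is again such a
  graph, as needed for Zorn's lemma. The last clause gives single-valuedness and injectivity at once,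
  by additivity.
\<close>

definition partial_iso :: "('a, 'r) ring_scheme \<Rightarrow> ('a \<times> 'a) set \<Rightarrow> bool" where
  "partial_iso R S \<longleftrightarrow> S \<subseteq> carrier R \<times> carrier R \<and> (\<zero>\<^bsub>R\<^esub>, \<zero>\<^bsub>R\<^esub>) \<in> S \<and>
     (\<forall>(x, y)\<in>S. \<forall>(x', y')\<in>S. (x \<oplus>\<^bsub>R\<^esub> x', y \<oplus>\<^bsub>R\<^esub> y') \<in> S) \<and>
     (\<forall>(x, y)\<in>S. \<forall>r\<in>carrier R. (x \<otimes>\<^bsub>R\<^esub> r, y \<otimes>\<^bsub>R\<^esub> r) \<in> S) \<and>
     (\<forall>(x, y)\<in>S. x = \<zero>\<^bsub>R\<^esub> \<longleftrightarrow> y = \<zero>\<^bsub>R\<^esub>)"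

context ring
begin

lemma diff_eq_zeroD:
  assumes "x \<in> carrier R" "y \<in> carrier R" "x \<ominus> y = \<zero>" shows "x = y"
  using assms minus_equality[of x "\<ominus> y"] by (simp add: minus_eq)

lemma right_idealI:
  assumes "I \<subseteq> carrier R" "\<zero> \<in> I"
    and "\<And>x y. \<lbrakk>x \<in> I; y \<in> I\<rbrakk> \<Longrightarrow> x \<oplus> y \<in> I"
    and mult: "\<And>x a. \<lbrakk>x \<in> I; a \<in> carrier R\<rbrakk> \<Longrightarrow> x \<otimes> a \<in> I"
  shows "right_ideal R I"
proof -
  have "\<ominus> x \<in> I" if "x \<in> I" for x
  proof -
    have "x \<otimes> (\<ominus> \<one>) \<in> I" using mult[OF that] by simp
    then show ?thesis using that assms(1) by (simp add: r_minus subset_iff)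
  qed
  then have "subgroup I (add_monoid R)"
    using assms by (intro subgroup.intro) (auto simp: a_inv_def)
  then show ?thesis using assms by (simp add: right_ideal_def additive_subgroup_def)
qed

lemma right_idealD:
  assumes "right_ideal R I"
  shows "x \<in> I \<Longrightarrow> x \<in> carrier R" "\<zero> \<in> I"
    and "\<lbrakk>x \<in> I; y \<in> I\<rbrakk> \<Longrightarrow> x \<oplus> y \<in> I"
    and "\<lbrakk>x \<in> I; a \<in> carrier R\<rbrakk> \<Longrightarrow> x \<otimes> a \<in> I"
    and "x \<in> I \<Longrightarrow> \<ominus> x \<in> I"
    and "\<lbrakk>x \<in> I; y \<in> I\<rbrakk> \<Longrightarrow> x \<ominus> y \<in> I"
proof -
  interpret additive_subgroup I R using assms by (simp add: right_ideal_def)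
  show "x \<in> I \<Longrightarrow> x \<in> carrier R" "\<zero> \<in> I" "\<lbrakk>x \<in> I; y \<in> I\<rbrakk> \<Longrightarrow> x \<oplus> y \<in> I"
    by simp_all
  show neg: "x \<in> I \<Longrightarrow> \<ominus> x \<in> I" for x
    using a_subgroup by (simp add: subgroup.m_inv_closed a_inv_def)
  show "\<lbrakk>x \<in> I; a \<in> carrier R\<rbrakk> \<Longrightarrow> x \<otimes> a \<in> I" using assms by (simp add: right_ideal_def)
  show "\<lbrakk>x \<in> I; y \<in> I\<rbrakk> \<Longrightarrow> x \<ominus> y \<in> I" by (simp add: minus_eq neg)
qed

lemma right_ideal_sum:
  assumes A: "right_ideal R A" and B: "right_ideal R B"
  shows "right_ideal R (A <+> B)"
proof (rule right_idealI)
  show "A <+> B \<subseteq> carrier R"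
    using right_idealD(1)[OF A] right_idealD(1)[OF B] by (auto simp: set_add_def')
  have "\<zero> = \<zero> \<oplus> \<zero>" by simp
  then show "\<zero> \<in> A <+> B"
    using right_idealD(2)[OF A] right_idealD(2)[OF B] unfolding set_add_def' by blast
next
  fix x y assume "x \<in> A <+> B" "y \<in> A <+> B"
  then obtain a b c d where *: "a \<in> A" "b \<in> B" "x = a \<oplus> b" "c \<in> A" "d \<in> B" "y = c \<oplus> d"
    by (auto simp: set_add_def')
  then have "a \<in> carrier R" "b \<in> carrier R" "c \<in> carrier R" "d \<in> carrier R"
    using right_idealD(1)[OF A] right_idealD(1)[OF B] by auto
  then have "x \<oplus> y = (a \<oplus> c) \<oplus> (b \<oplus> d)" using * by (simp add: a_ac)
  moreover have "a \<oplus> c \<in> A" "b \<oplus> d \<in> B" using * A B by (simp_all add: right_idealD)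
  ultimately show "x \<oplus> y \<in> A <+> B" by (auto simp: set_add_def')
next
  fix x r assume "x \<in> A <+> B" and r: "r \<in> carrier R"
  then obtain a b where *: "a \<in> A" "b \<in> B" "x = a \<oplus> b" by (auto simp: set_add_def')
  then have "x \<otimes> r = a \<otimes> r \<oplus> b \<otimes> r"
    using right_idealD(1)[OF A] right_idealD(1)[OF B] r by (simp add: l_distr)
  moreover have "a \<otimes> r \<in> A" "b \<otimes> r \<in> B" using * A B r by (simp_all add: right_idealD)
  ultimately show "x \<otimes> r \<in> A <+> B" by (auto simp: set_add_def')
qed

lemma set_add_memI: "\<lbrakk>a \<in> A; b \<in> B\<rbrakk> \<Longrightarrow> a \<oplus> b \<in> A <+> B"
  by (auto simp: set_add_def')

lemma set_add_memE:
  assumes "x \<in> A <+> B" obtains a b where "a \<in> A" "b \<in> B" "x = a \<oplus> b"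
  using assms by (auto simp: set_add_def')

lemma right_ideal_sum_upper:
  assumes A: "right_ideal R A" and B: "right_ideal R B"
  shows "A \<subseteq> A <+> B" "B \<subseteq> A <+> B"
proof -
  show "A \<subseteq> A <+> B"
  proof
    fix x assume "x \<in> A"
    then show "x \<in> A <+> B"
      using set_add_memI[of x A \<zero> B] right_idealD(1)[OF A] right_idealD(2)[OF B] by simp
  qed
  show "B \<subseteq> A <+> B"
  proof
    fix x assume "x \<in> B"
    then show "x \<in> A <+> B"
      using set_add_memI[of \<zero> A x B] right_idealD(1)[OF B] right_idealD(2)[OF A] by simp
  qed
qed

lemma right_ideal_image:
  assumes a: "a \<in> carrier R" and I: "right_ideal R I"
  shows "right_ideal R ((\<otimes>) a ` I)"
proof (rule right_idealI)
  show "(\<otimes>) a ` I \<subseteq> carrier R" using a right_idealD(1)[OF I] by auto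
  show "\<zero> \<in> (\<otimes>) a ` I"
    using a right_idealD(2)[OF I] by (intro image_eqI[of _ _ \<zero>]) auto
  fix x assume "x \<in> (\<otimes>) a ` I"
  then obtain i where i: "i \<in> I" "x = a \<otimes> i" by auto
  show "x \<otimes> r \<in> (\<otimes>) a ` I" if r: "r \<in> carrier R" for r
    using a i r right_idealD(1,4)[OF I]
    by (intro image_eqI[of _ _ "i \<otimes> r"]) (auto simp: m_assoc)
  fix y assume "y \<in> (\<otimes>) a ` I"
  then obtain j where j: "j \<in> I" "y = a \<otimes> j" by auto
  show "x \<oplus> y \<in> (\<otimes>) a ` I"
    using a i j right_idealD(1,3)[OF I]
    by (intro image_eqI[of _ _ "i \<oplus> j"]) (auto simp: r_distr)
qed

lemma right_ideal_principal: "a \<in> carrier R \<Longrightarrow> right_ideal R ((\<otimes>) a ` carrier R)"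
  by (rule right_ideal_image[OF _ right_ideal_carrier[OF ring_axioms]])

lemma essential_right_idealD:
  assumes "essential_right_ideal R I"
  shows "right_ideal R I"
    and "\<lbrakk>x \<in> carrier R; x \<noteq> \<zero>\<rbrakk> \<Longrightarrow> \<exists>r\<in>carrier R. x \<otimes> r \<in> I \<and> x \<otimes> r \<noteq> \<zero>"
  using assms by (auto simp: essential_right_ideal_def)

lemma essential_right_ideal_mono:
  assumes "essential_right_ideal R I" "right_ideal R J" "I \<subseteq> J"
  shows "essential_right_ideal R J"
  using assms unfolding essential_right_ideal_def by blast

lemma essential_right_ideal_carrier: "essential_right_ideal R (carrier R)"
  unfolding essential_right_ideal_def
  using right_ideal_carrier[OF ring_axioms] r_one one_closed by metis

text \<open>The complement is a right ideal that is maximal among those meeting \<open>A\<close> in zero.\<close>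

lemma complement_exists:
  assumes A: "right_ideal R A"
  obtains C where "right_ideal R C" "A \<inter> C = {\<zero>}" "essential_right_ideal R (A <+> C)"
proof -
  define F where "F = {C. right_ideal R C \<and> A \<inter> C = {\<zero>}}"
  have "\<exists>C\<in>F. \<forall>D\<in>F. C \<subseteq> D \<longrightarrow> D = C"
  proof (rule subset_Zorn_nonempty)
    have "right_ideal R {\<zero>}" by (rule right_idealI) auto
    then show "F \<noteq> {}" using right_idealD(2)[OF A] by (auto simp: F_def)
    fix \<C> assume C: "\<C> \<noteq> {}" "subset.chain F \<C>"
    have sub: "right_ideal R D" "A \<inter> D = {\<zero>}" if "D \<in> \<C>" for D
      using C(2) that by (auto simp: subset.chain_def F_def)
    have ch: "D \<subseteq> D' \<or> D' \<subseteq> D" if "D \<in> \<C>" "D' \<in> \<C>" for D D'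
      using C(2) that unfolding subset_chain_def by blast
    have "right_ideal R (\<Union>\<C>)"
    proof (rule right_idealI)
      show "\<Union>\<C> \<subseteq> carrier R" using right_idealD(1)[OF sub(1)] by blast
      show "\<zero> \<in> \<Union>\<C>" using C(1) right_idealD(2)[OF sub(1)] by blast
      show "x \<otimes> a \<in> \<Union>\<C>" if "x \<in> \<Union>\<C>" "a \<in> carrier R" for x a
        using right_idealD(4)[OF sub(1)] that by blast
      fix x y assume "x \<in> \<Union>\<C>" "y \<in> \<Union>\<C>"
      then obtain D D' where D: "D \<in> \<C>" "D' \<in> \<C>" "x \<in> D" "y \<in> D'" by blast
      then obtain D'' where "D'' \<in> \<C>" "x \<in> D''" "y \<in> D''" using ch[OF D(1,2)] by blast
      then show "x \<oplus> y \<in> \<Union>\<C>" using right_idealD(3)[OF sub(1)] by blast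
    qed
    moreover have "A \<inter> \<Union>\<C> = {\<zero>}" using sub(2) C(1) by blast
    ultimately show "\<Union>\<C> \<in> F" by (simp add: F_def)
  qed
  then obtain C where CF: "C \<in> F" and max: "\<And>D. \<lbrakk>D \<in> F; C \<subseteq> D\<rbrakk> \<Longrightarrow> D = C" by blast
  have C: "right_ideal R C" "A \<inter> C = {\<zero>}" using CF by (auto simp: F_def)
  note Ac = right_idealD(1)[OF A] and Cc = right_idealD(1)[OF C(1)]
  have "\<exists>r\<in>carrier R. x \<otimes> r \<in> A <+> C \<and> x \<otimes> r \<noteq> \<zero>"
    if x: "x \<in> carrier R" "x \<noteq> \<zero>" for x
  proof (rule ccontr)
    assume neg: "\<not> ?thesis"
    let ?P = "(\<otimes>) x ` carrier R"
    have P: "right_ideal R ?P" by (rule right_ideal_principal[OF x(1)])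
    have "a = \<zero>" if a: "a \<in> A" "a \<in> C <+> ?P" for a
    proof -
      obtain c r where *: "c \<in> C" "r \<in> carrier R" "a = c \<oplus> x \<otimes> r"
        using a(2) by (auto elim: set_add_memE)
      have "x \<otimes> r = a \<oplus> \<ominus> c" using * Cc x(1) by (simp add: a_ac r_neg2)
      then have "x \<otimes> r \<in> A <+> C"
        using set_add_memI[OF a(1) right_idealD(5)[OF C(1) *(1)]] by simp
      then have "x \<otimes> r = \<zero>" using neg *(2) by blast
      then have "a = c" using * Cc by simp
      then show ?thesis using C(2) *(1) a(1) by blast
    qed
    then have "A \<inter> (C <+> ?P) = {\<zero>}"
      using right_idealD(2)[OF A] right_idealD(2)[OF right_ideal_sum[OF C(1) P]] by blast
    then have "C <+> ?P \<in> F" using right_ideal_sum[OF C(1) P] by (simp add: F_def)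
    then have "C <+> ?P = C" using max right_ideal_sum_upper(1)[OF C(1) P] by blast
    moreover have "x \<in> ?P" using x(1) by (intro image_eqI[of _ _ \<one>]) auto
    ultimately have "x \<in> A <+> C"
      using right_ideal_sum_upper(2)[OF C(1) P] right_ideal_sum_upper(2)[OF A C(1)] by blast
    then show False using neg x by (metis one_closed r_one)
  qed
  then have "essential_right_ideal R (A <+> C)"
    using right_ideal_sum[OF A C(1)] by (simp add: essential_right_ideal_def)
  then show ?thesis using C that by blast
qed

lemma partial_isoD:
  assumes "partial_iso R S"
  shows "(x, y) \<in> S \<Longrightarrow> x \<in> carrier R" "(x, y) \<in> S \<Longrightarrow> y \<in> carrier R"
    and "(\<zero>, \<zero>) \<in> S"
    and "\<lbrakk>(x, y) \<in> S; (x', y') \<in> S\<rbrakk> \<Longrightarrow> (x \<oplus> x', y \<oplus> y') \<in> S"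
    and "\<lbrakk>(x, y) \<in> S; r \<in> carrier R\<rbrakk> \<Longrightarrow> (x \<otimes> r, y \<otimes> r) \<in> S"
    and "(x, y) \<in> S \<Longrightarrow> x = \<zero> \<longleftrightarrow> y = \<zero>"
  using assms unfolding partial_iso_def by blast+

lemma partial_isoI:
  assumes "\<And>x y. (x, y) \<in> S \<Longrightarrow> x \<in> carrier R \<and> y \<in> carrier R"
    and "(\<zero>, \<zero>) \<in> S"
    and "\<And>x y x' y'. \<lbrakk>(x, y) \<in> S; (x', y') \<in> S\<rbrakk> \<Longrightarrow> (x \<oplus> x', y \<oplus> y') \<in> S"
    and "\<And>x y r. \<lbrakk>(x, y) \<in> S; r \<in> carrier R\<rbrakk> \<Longrightarrow> (x \<otimes> r, y \<otimes> r) \<in> S"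
    and "\<And>x y. (x, y) \<in> S \<Longrightarrow> x = \<zero> \<longleftrightarrow> y = \<zero>"
  shows "partial_iso R S"
  unfolding partial_iso_def
proof (intro conjI)
  show "S \<subseteq> carrier R \<times> carrier R" using assms(1) by auto
  show "(\<zero>, \<zero>) \<in> S" by (rule assms(2))
  show "\<forall>(x, y)\<in>S. \<forall>(x', y')\<in>S. (x \<oplus> x', y \<oplus> y') \<in> S" using assms(3) by auto
  show "\<forall>(x, y)\<in>S. \<forall>r\<in>carrier R. (x \<otimes> r, y \<otimes> r) \<in> S" using assms(4) by auto
  show "\<forall>(x, y)\<in>S. x = \<zero> \<longleftrightarrow> y = \<zero>" using assms(5) by auto
qed

lemma partial_iso_converse:
  assumes "partial_iso R S" shows "partial_iso R (S\<inverse>)"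
  by (rule partial_isoI) (use partial_isoD[OF assms] in auto)

lemma partial_iso_Domain:
  assumes "partial_iso R S" shows "right_ideal R (Domain S)"
proof (rule right_idealI)
  fix x y assume "x \<in> Domain S" "y \<in> Domain S"
  then show "x \<oplus> y \<in> Domain S" using partial_isoD(4)[OF assms] by blast
next
  fix x a assume "x \<in> Domain S" "a \<in> carrier R"
  then show "x \<otimes> a \<in> Domain S" using partial_isoD(5)[OF assms] by blast
qed (use partial_isoD[OF assms] in blast)+

lemma partial_iso_Range:
  assumes "partial_iso R S" shows "right_ideal R (Range S)"
  using partial_iso_Domain[OF partial_iso_converse[OF assms]] by simp

lemma partial_iso_unique:
  assumes S: "partial_iso R S" and "(x, y) \<in> S" "(x, y') \<in> S"
  shows "y = y'"
proof -
  note c = partial_isoD(1,2)[OF S]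
  have "(x \<otimes> \<ominus> \<one>, y' \<otimes> \<ominus> \<one>) \<in> S" by (rule partial_isoD(5)[OF S assms(3)]) simp
  then have "(x \<oplus> x \<otimes> \<ominus> \<one>, y \<oplus> y' \<otimes> \<ominus> \<one>) \<in> S" by (rule partial_isoD(4)[OF S assms(2)])
  then have "(\<zero>, y \<ominus> y') \<in> S"
    using c[OF assms(2)] c[OF assms(3)] by (simp add: r_minus r_neg minus_eq)
  then have "y \<ominus> y' = \<zero>" using partial_isoD(6)[OF S] by blast
  then show ?thesis using c[OF assms(2)] c[OF assms(3)] using diff_eq_zeroD by blast
qed

lemma partial_iso_sum:
  assumes S: "partial_iso R S" and T: "partial_iso R T"
    and dom: "Domain S \<inter> Domain T = {\<zero>}" and ran: "Range S \<inter> Range T = {\<zero>}"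
  defines "P \<equiv> {(x \<oplus> x', y \<oplus> y') | x y x' y'. (x, y) \<in> S \<and> (x', y') \<in> T}"
  shows "partial_iso R P" "Domain P = Domain S <+> Domain T" "Range P = Range S <+> Range T"
    and "S \<subseteq> P" "T \<subseteq> P"
proof -
  note Sc = partial_isoD(1,2)[OF S] and Tc = partial_isoD(1,2)[OF T]
  have PI: "(x \<oplus> x', y \<oplus> y') \<in> P" if "(x, y) \<in> S" "(x', y') \<in> T" for x y x' y'
    unfolding P_def using that by blast
  have indep: "a = \<zero> \<and> b = \<zero>"
    if "right_ideal R A" "right_ideal R B" "A \<inter> B = {\<zero>}" "a \<in> A" "b \<in> B" "a \<oplus> b = \<zero>" for A B a b
  proof -
    have c: "a \<in> carrier R" "b \<in> carrier R"
      using right_idealD(1)[OF that(1,4)] right_idealD(1)[OF that(2,5)] by auto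
    have "a = \<ominus> b" using that(6) c by (simp add: minus_equality)
    then have "a \<in> B" using right_idealD(5)[OF that(2,5)] by simp
    then have "a = \<zero>" using that(3,4) by blast
    then show ?thesis using that(6) c by simp
  qed
  show "partial_iso R P"
  proof (rule partial_isoI)
    have "(\<zero> \<oplus> \<zero>, \<zero> \<oplus> \<zero>) \<in> P" by (rule PI[OF partial_isoD(3)[OF S] partial_isoD(3)[OF T]])
    then show "(\<zero>, \<zero>) \<in> P" by simp
    fix u v assume "(u, v) \<in> P"
    then obtain x y x' y' where 1: "(x, y) \<in> S" "(x', y') \<in> T" "u = x \<oplus> x'" "v = y \<oplus> y'"
      by (auto simp: P_def)
    show "u \<in> carrier R \<and> v \<in> carrier R" using 1 Sc Tc by simp
    show "(u \<otimes> r, v \<otimes> r) \<in> P" if r: "r \<in> carrier R" for r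
      using PI[OF partial_isoD(5)[OF S 1(1) r] partial_isoD(5)[OF T 1(2) r]] 1 Sc Tc r
      by (simp add: l_distr)
    show "u = \<zero> \<longleftrightarrow> v = \<zero>"
    proof
      assume "u = \<zero>"
      then have "x = \<zero> \<and> x' = \<zero>"
        using 1 by (intro indep[OF partial_iso_Domain[OF S] partial_iso_Domain[OF T] dom]) auto
      then show "v = \<zero>" using 1 partial_isoD(6)[OF S 1(1)] partial_isoD(6)[OF T 1(2)] by simp
    next
      assume "v = \<zero>"
      then have "y = \<zero> \<and> y' = \<zero>"
        using 1 by (intro indep[OF partial_iso_Range[OF S] partial_iso_Range[OF T] ran]) auto
      then show "u = \<zero>" using 1 partial_isoD(6)[OF S 1(1)] partial_isoD(6)[OF T 1(2)] by simp
    qed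
    fix u' v' assume "(u', v') \<in> P"
    then obtain z w z' w' where 2: "(z, w) \<in> S" "(z', w') \<in> T" "u' = z \<oplus> z'" "v' = w \<oplus> w'"
      by (auto simp: P_def)
    have "(u \<oplus> u', v \<oplus> v') = ((x \<oplus> z) \<oplus> (x' \<oplus> z'), (y \<oplus> w) \<oplus> (y' \<oplus> w'))"
      using 1 2 Sc[OF 1(1)] Sc[OF 2(1)] Tc[OF 1(2)] Tc[OF 2(2)] by (simp add: a_ac)
    then show "(u \<oplus> u', v \<oplus> v') \<in> P"
      using PI[OF partial_isoD(4)[OF S 1(1) 2(1)] partial_isoD(4)[OF T 1(2) 2(2)]] by simp
  qed
  show "Domain P = Domain S <+> Domain T" "Range P = Range S <+> Range T"
    unfolding set_add_def' P_def by blast+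
  show "S \<subseteq> P"
  proof (rule subrelI)
    fix x y assume "(x, y) \<in> S"
    then show "(x, y) \<in> P" using PI[OF _ partial_isoD(3)[OF T], of x y] Sc by simp
  qed
  show "T \<subseteq> P"
  proof (rule subrelI)
    fix x y assume "(x, y) \<in> T"
    then show "(x, y) \<in> P" using PI[OF partial_isoD(3)[OF S], of x y] Tc by simp
  qed
qed

lemma partial_iso_Id_on:
  assumes "right_ideal R I" shows "partial_iso R (Id_on I)"
  by (rule partial_isoI) (use right_idealD[OF assms] in auto)

lemma partial_iso_mult:
  assumes a: "a \<in> carrier R" and I: "right_ideal R I"
    and inj: "\<And>x. \<lbrakk>x \<in> I; a \<otimes> x = \<zero>\<rbrakk> \<Longrightarrow> x = \<zero>"
  shows "partial_iso R {(x, a \<otimes> x) | x. x \<in> I}"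
proof (rule partial_isoI)
  show "(\<zero>, \<zero>) \<in> {(x, a \<otimes> x) | x. x \<in> I}" using a right_idealD(2)[OF I] by simp
qed (use a right_idealD[OF I] inj in \<open>auto simp: r_distr m_assoc\<close>)

lemma partial_iso_restrict:
  assumes S: "partial_iso R S" and W: "right_ideal R W"
  shows "partial_iso R {(x, y) \<in> S. x \<in> W}"
  by (rule partial_isoI) (use partial_isoD[OF S] right_idealD[OF W] in auto)

end

section \<open>Extending isomorphisms to ring elements\<close>

text \<open>
  This makes an injective envelope of \<open>R\<close> an injective envelope of every essential right ideal, so
  that one automorphism of it can be tested against all of them.
\<close>

lemma essential_mono_right_ideal:
  assumes R: "ring R" and I: "essential_right_ideal R I" and E: "right_module R E"
    and ess: "essential_mono R (right_ideal_module R (carrier R)) E \<kappa>"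
  shows "essential_mono R (right_ideal_module R I) E \<kappa>"
proof -
  interpret ring R by fact
  let ?R = "right_ideal_module R (carrier R)"
  have Ir: "right_ideal R I" by (rule essential_right_idealD(1)[OF I])
  have \<kappa>: "\<kappa> \<in> rmod_hom R ?R E" and inj: "inj_on \<kappa> (carrier R)"
    using ess by (auto simp: essential_mono_def rmod_mono_def right_ideal_module_def)
  have \<kappa>0: "\<kappa> \<zero>\<^bsub>R\<^esub> = \<zero>\<^bsub>E\<^esub>"
    using rmod_hom_zero[OF right_ideal_rmod[OF R right_ideal_carrier[OF R]] E \<kappa>]
    by (simp add: right_ideal_module_def)
  have "\<kappa> \<in> rmod_mono R (right_ideal_module R I) E"
    using \<kappa> inj right_idealD(1)[OF Ir] inj_on_subset[OF inj, of I]
    by (auto simp: rmod_mono_def rmod_hom_def right_ideal_module_def)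
  moreover have "N \<inter> \<kappa> ` I \<noteq> {\<zero>\<^bsub>E\<^esub>}" if N: "right_submodule R E N" "N \<noteq> {\<zero>\<^bsub>E\<^esub>}" for N
  proof -
    have "N \<inter> \<kappa> ` carrier R \<noteq> {\<zero>\<^bsub>E\<^esub>}"
      using ess N by (simp add: essential_mono_def right_ideal_module_def)
    moreover have "\<zero>\<^bsub>E\<^esub> \<in> N \<inter> \<kappa> ` carrier R"
      using N(1) \<kappa>0 additive_subgroup.zero_closed[of N E]
      by (auto simp: right_submodule_def intro!: image_eqI[of _ _ "\<zero>\<^bsub>R\<^esub>"])
    ultimately obtain x where x: "x \<in> carrier R" "\<kappa> x \<in> N" "\<kappa> x \<noteq> \<zero>\<^bsub>E\<^esub>" by blast
    then have "x \<noteq> \<zero>\<^bsub>R\<^esub>" using \<kappa>0 by auto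
    then obtain r where r: "r \<in> carrier R" "x \<otimes>\<^bsub>R\<^esub> r \<in> I" "x \<otimes>\<^bsub>R\<^esub> r \<noteq> \<zero>\<^bsub>R\<^esub>"
      using essential_right_idealD(2)[OF I x(1)] by blast
    have "\<kappa> (x \<otimes>\<^bsub>R\<^esub> r) = \<kappa> x \<star>\<^bsub>E\<^esub> r"
      using rmod_homD(3)[OF \<kappa>, of x r] x(1) r(1) by (simp add: right_ideal_module_def)
    then have "\<kappa> (x \<otimes>\<^bsub>R\<^esub> r) \<in> N" using N(1) x(2) r(1) by (simp add: right_submodule_def)
    moreover have "\<kappa> (x \<otimes>\<^bsub>R\<^esub> r) \<noteq> \<zero>\<^bsub>E\<^esub>"
      using inj_onD[OF inj, of "x \<otimes>\<^bsub>R\<^esub> r" "\<zero>\<^bsub>R\<^esub>"] r x(1) \<kappa>0 by auto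
    ultimately show ?thesis using r(2) by blast
  qed
  ultimately show ?thesis by (simp add: essential_mono_def right_ideal_module_def)
qed

text \<open>
  Extend the isomorphism to an endomorphism \<open>\<phi>\<close> of the envelope \<open>E\<close> of \<open>R\<close>. It is injective, because
  it is so on an essential submodule. A left inverse of \<open>\<phi>\<close> is injective as well, because it inverts
  \<open>\<phi>\<close> on the essential range, so \<open>\<phi>\<close> is an automorphism. The witness \<open>u\<close> is the image of \<open>1\<close>,
  which lies in \<open>R\<close> by invariance of \<open>R\<close>; the last clause is invariance of \<open>I\<close>.
\<close>

lemma a_ring_extend_partial_iso:
  fixes R :: "('a, 'r) ring_scheme"
  assumes a: "right_a_ring TYPE('e) R"
    and S: "partial_iso R S"
    and dom: "essential_right_ideal R (Domain S)" and ran: "essential_right_ideal R (Range S)"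
  shows "\<exists>u\<in>carrier R. (\<forall>x y. (x, y) \<in> S \<longrightarrow> u \<otimes>\<^bsub>R\<^esub> x = y) \<and>
    (\<forall>I z. essential_right_ideal R I \<longrightarrow> z \<in> I \<longrightarrow> u \<otimes>\<^bsub>R\<^esub> z \<in> I)"
proof -
  have R: "ring R" using a by (simp add: right_a_ring_def)
  interpret ring R by fact
  let ?M = "right_ideal_module R"
  have mod: "right_module R (?M I)" if "right_ideal R I" for I
    by (rule right_ideal_rmod[OF R that])
  have modR: "right_module R (?M (carrier R))" by (rule mod[OF right_ideal_carrier[OF R]])
  have Mc: "carrier (?M I) = I" for I by (simp add: right_ideal_module_def)
  obtain E :: "('a, 'e) right_module" and \<kappa>
    where E: "injective_envelope R (?M (carrier R)) E \<kappa>"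
    using a right_ideal_carrier[OF R]
    unfolding right_a_ring_def automorphism_invariant_def by metis
  have inj: "injective_rmod R E" and ess: "essential_mono R (?M (carrier R)) E \<kappa>"
    using E by (auto simp: injective_envelope_def)
  have Em: "right_module R E" using inj by (simp add: injective_rmod_def)
  note essI = essential_mono_right_ideal[OF R _ Em ess]
  have \<kappa>: "\<kappa> \<in> rmod_hom R (?M (carrier R)) E" and \<kappa>inj: "inj_on \<kappa> (carrier R)"
    using ess by (auto simp: essential_mono_def rmod_mono_def Mc)
  have mono: "\<kappa> \<in> rmod_mono R (?M I) E" if "essential_right_ideal R I" for I
    using essI[OF that] by (simp add: essential_mono_def)
  define h where "h x = (THE y. (x, y) \<in> S)" for x
  have h: "h x = y" if "(x, y) \<in> S" for x y
    unfolding h_def using that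
    by (rule the_equality) (rule partial_iso_unique[OF S _ that])
  note Sc = partial_isoD(1,2)[OF S]
  have "(\<lambda>x. \<kappa> (h x)) \<in> rmod_hom R (?M (Domain S)) E"
  proof (rule rmod_homI; unfold Mc)
    fix x assume "x \<in> Domain S"
    then obtain y where y: "(x, y) \<in> S" by blast
    show "\<kappa> (h x) \<in> carrier E" using rmod_homD(1)[OF \<kappa>] Sc[OF y] h[OF y] by (simp add: Mc)
    show "\<kappa> (h (x \<star>\<^bsub>?M (Domain S)\<^esub> r)) = \<kappa> (h x) \<star>\<^bsub>E\<^esub> r" if r: "r \<in> carrier R" for r
      using rmod_homD(3)[OF \<kappa>, of y r] Sc[OF y] h[OF y] h[OF partial_isoD(5)[OF S y r]] r
      by (simp add: right_ideal_module_def)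
    fix x' assume "x' \<in> Domain S"
    then obtain y' where y': "(x', y') \<in> S" by blast
    show "\<kappa> (h (x \<oplus>\<^bsub>?M (Domain S)\<^esub> x')) = \<kappa> (h x) \<oplus>\<^bsub>E\<^esub> \<kappa> (h x')"
      using rmod_homD(2)[OF \<kappa>, of y y'] Sc[OF y] Sc[OF y'] h[OF y] h[OF y']
        h[OF partial_isoD(4)[OF S y y']]
      by (simp add: right_ideal_module_def)
  qed
  then obtain \<phi> where \<phi>: "\<phi> \<in> rmod_hom R E E"
    and "\<forall>x\<in>carrier (?M (Domain S)). \<phi> (\<kappa> x) = \<kappa> (h x)"
    using injective_extend[OF inj mod[OF essential_right_idealD(1)[OF dom]] Em mono[OF dom]]
    by blast
  then have \<phi>S: "\<phi> (\<kappa> x) = \<kappa> y" if "(x, y) \<in> S" for x y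
    using that h[OF that] by (auto simp: Mc)
  have "inj_on (\<lambda>x. \<phi> (\<kappa> x)) (Domain S)"
  proof (rule inj_onI)
    fix x x' assume "x \<in> Domain S" "x' \<in> Domain S" and eq: "\<phi> (\<kappa> x) = \<phi> (\<kappa> x')"
    then obtain y y' where y: "(x, y) \<in> S" "(x', y') \<in> S" by blast
    then have "y = y'" using inj_onD[OF \<kappa>inj] eq \<phi>S Sc by metis
    then show "x = x'" using partial_iso_unique[OF partial_iso_converse[OF S], of y] y by simp
  qed
  then have \<phi>inj: "inj_on \<phi> (carrier E)"
    using essential_hom_inj[OF mod[OF essential_right_idealD(1)[OF dom]] Em Em essI[OF dom] \<phi>]
    by (simp add: Mc)
  have "\<phi> \<in> rmod_mono R E E" using \<phi> \<phi>inj by (simp add: rmod_mono_def)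
  moreover have "(\<lambda>x. x) \<in> rmod_hom R E E" by (simp add: rmod_hom_def)
  ultimately obtain \<psi> where \<psi>: "\<psi> \<in> rmod_hom R E E" and \<psi>\<phi>: "\<forall>x\<in>carrier E. \<psi> (\<phi> x) = x"
    using injective_extend[OF inj Em Em, of \<phi> "\<lambda>x. x"] by blast
  have \<psi>S: "\<psi> (\<kappa> y) = \<kappa> x" if "(x, y) \<in> S" for x y
    using \<psi>\<phi> \<phi>S[OF that] rmod_homD(1)[OF \<kappa>, of x] Sc[OF that] by (metis Mc)
  have "inj_on (\<lambda>y. \<psi> (\<kappa> y)) (Range S)"
  proof (rule inj_onI)
    fix y y' assume "y \<in> Range S" "y' \<in> Range S" and eq: "\<psi> (\<kappa> y) = \<psi> (\<kappa> y')"
    then obtain x x' where x: "(x, y) \<in> S" "(x', y') \<in> S" by blast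
    then have "x = x'" using inj_onD[OF \<kappa>inj] eq \<psi>S Sc by metis
    then show "y = y'" using partial_iso_unique[OF S, of x] x by simp
  qed
  then have \<psi>inj: "inj_on \<psi> (carrier E)"
    using essential_hom_inj[OF mod[OF essential_right_idealD(1)[OF ran]] Em Em essI[OF ran] \<psi>]
    by (simp add: Mc)
  have \<phi>\<psi>: "\<phi> (\<psi> z) = z" if z: "z \<in> carrier E" for z
  proof (rule inj_onD[OF \<psi>inj _ _ z])
    have "\<psi> z \<in> carrier E" by (rule rmod_homD(1)[OF \<psi> z])
    then show "\<psi> (\<phi> (\<psi> z)) = \<psi> z" "\<phi> (\<psi> z) \<in> carrier E"
      using \<psi>\<phi> rmod_homD(1)[OF \<phi>] by blast+
  qed
  have "\<phi> ` carrier E \<subseteq> carrier E" "\<psi> ` carrier E \<subseteq> carrier E"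
    using rmod_homD(1)[OF \<phi>] rmod_homD(1)[OF \<psi>] by auto
  then have "bij_betw \<phi> (carrier E) (carrier E)"
    using \<psi>\<phi> \<phi>\<psi> by (intro bij_betw_byWitness[where f' = \<psi>]) auto
  then have aut: "\<phi> \<in> rmod_aut R E" using \<phi> by (simp add: rmod_aut_def)
  have inv: "\<phi> (\<kappa> z) \<in> \<kappa> ` I" if I: "essential_right_ideal R I" and z: "z \<in> I" for I z
  proof -
    have "injective_envelope R (?M I) E \<kappa>"
      using inj essI[OF I] by (simp add: injective_envelope_def)
    moreover have "automorphism_invariant TYPE('e) R (?M I)"
      using a essential_right_idealD(1)[OF I] by (simp add: right_a_ring_def)
    ultimately have "\<phi> ` \<kappa> ` I \<subseteq> \<kappa> ` I"
      using automorphism_invariant_all[OF mod[OF essential_right_idealD(1)[OF I]] _ _ aut]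
      by (metis Mc)
    then show ?thesis using z by blast
  qed
  obtain u where u: "u \<in> carrier R" "\<phi> (\<kappa> \<one>\<^bsub>R\<^esub>) = \<kappa> u"
    using inv[OF essential_right_ideal_carrier one_closed] by blast
  have \<phi>u: "\<phi> (\<kappa> z) = \<kappa> (u \<otimes>\<^bsub>R\<^esub> z)" if z: "z \<in> carrier R" for z
  proof -
    have mult: "\<kappa> (x \<otimes>\<^bsub>R\<^esub> z) = \<kappa> x \<star>\<^bsub>E\<^esub> z" if "x \<in> carrier R" for x
      using rmod_homD(3)[OF \<kappa>, of x z] that z by (simp add: right_ideal_module_def)
    have "\<kappa> \<one>\<^bsub>R\<^esub> \<in> carrier E" using rmod_homD(1)[OF \<kappa>] by (simp add: Mc)
    then show ?thesis
      using mult[OF one_closed] mult[OF u(1)] rmod_homD(3)[OF \<phi>, of "\<kappa> \<one>\<^bsub>R\<^esub>" z] u z by simp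
  qed
  have "u \<otimes>\<^bsub>R\<^esub> x = y" if "(x, y) \<in> S" for x y
    using \<phi>S[OF that] \<phi>u[of x] Sc[OF that] u(1) by (metis inj_onD[OF \<kappa>inj] m_closed)
  moreover have "u \<otimes>\<^bsub>R\<^esub> z \<in> I" if I: "essential_right_ideal R I" and z: "z \<in> I" for I z
  proof -
    note Ic = right_idealD(1)[OF essential_right_idealD(1)[OF I]]
    obtain i where "i \<in> I" "\<kappa> (u \<otimes>\<^bsub>R\<^esub> z) = \<kappa> i" using inv[OF I z] \<phi>u[OF Ic[OF z]] by auto
    then show ?thesis using inj_onD[OF \<kappa>inj] Ic z u(1) by (metis m_closed)
  qed
  ultimately show ?thesis using u(1) by blast
qed



section \<open>Semiprime rings are nonsingular\<close>

definition right_annihilator :: "('a, 'r) ring_scheme \<Rightarrow> 'a \<Rightarrow> 'a set" where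
  "right_annihilator R w = {x \<in> carrier R. w \<otimes>\<^bsub>R\<^esub> x = \<zero>\<^bsub>R\<^esub>}"

context ring
begin

lemma right_ideal_annihilator: "w \<in> carrier R \<Longrightarrow> right_ideal R (right_annihilator R w)"
  by (rule right_idealI) (auto simp: right_annihilator_def r_distr m_assoc[symmetric])

lemma essential_right_ideal_quotient:
  assumes L: "essential_right_ideal R L" and s: "s \<in> carrier R"
  shows "essential_right_ideal R {x \<in> carrier R. s \<otimes> x \<in> L}"
proof -
  note Lr = essential_right_idealD(1)[OF L]
  have "right_ideal R {x \<in> carrier R. s \<otimes> x \<in> L}"
  proof (rule right_idealI)
    show "x \<otimes> r \<in> {x \<in> carrier R. s \<otimes> x \<in> L}"
      if "x \<in> {x \<in> carrier R. s \<otimes> x \<in> L}" "r \<in> carrier R" for x r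
      using that s right_idealD(4)[OF Lr, of "s \<otimes> x" r] by (simp add: m_assoc)
  qed (use s right_idealD[OF Lr] in \<open>auto simp: r_distr\<close>)
  moreover have "\<exists>r\<in>carrier R. x \<otimes> r \<in> {x \<in> carrier R. s \<otimes> x \<in> L} \<and> x \<otimes> r \<noteq> \<zero>"
    if x: "x \<in> carrier R" "x \<noteq> \<zero>" for x
  proof (cases "s \<otimes> x = \<zero>")
    case True
    then show ?thesis using x right_idealD(2)[OF Lr] by (intro bexI[of _ \<one>]) auto
  next
    case False
    then obtain r where r: "r \<in> carrier R" "s \<otimes> x \<otimes> r \<in> L" "s \<otimes> x \<otimes> r \<noteq> \<zero>"
      using essential_right_idealD(2)[OF L, of "s \<otimes> x"] s x by auto
    have eq: "s \<otimes> (x \<otimes> r) = s \<otimes> x \<otimes> r" using s x r by (simp add: m_assoc)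
    have "x \<otimes> r \<noteq> \<zero>"
    proof
      assume "x \<otimes> r = \<zero>"
      then have "s \<otimes> (x \<otimes> r) = \<zero>" using s by simp
      then show False using r(3) eq by simp
    qed
    then show ?thesis using r x eq by (intro bexI[of _ r]) auto
  qed
  ultimately show ?thesis by (simp add: essential_right_ideal_def)
qed

text \<open>
  Let \<open>J\<close> be the right annihilator of \<open>aR\<close>, and intersect \<open>J\<close> with its own left annihilator. This is an
  ideal with square zero, and it contains \<open>a\<close>.
\<close>

lemma semiprime_ring_element:
  assumes semiprime: "semiprime_ring R" and a: "a \<in> carrier R"
    and aRa: "\<And>r. r \<in> carrier R \<Longrightarrow> a \<otimes> r \<otimes> a = \<zero>"
  shows "a = \<zero>"
proof -
  define J where "J = {x \<in> carrier R. \<forall>r\<in>carrier R. a \<otimes> r \<otimes> x = \<zero>}"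
  define I where "I = {y \<in> J. \<forall>x\<in>J. y \<otimes> x = \<zero>}"
  have Jc: "x \<in> carrier R" if "x \<in> J" for x using that by (simp add: J_def)
  have Jl: "s \<otimes> x \<in> J" if x: "x \<in> J" and s: "s \<in> carrier R" for x s
  proof -
    have "a \<otimes> r \<otimes> (s \<otimes> x) = \<zero>" if r: "r \<in> carrier R" for r
    proof -
      have "a \<otimes> r \<otimes> (s \<otimes> x) = a \<otimes> (r \<otimes> s) \<otimes> x" using a r s Jc[OF x] by (simp add: m_assoc)
      then show ?thesis using x r s by (simp add: J_def)
    qed
    then show ?thesis using s Jc[OF x] by (simp add: J_def)
  qed
  have J: "right_ideal R J"
    by (rule right_idealI) (use a in \<open>auto simp: J_def r_distr m_assoc[symmetric]\<close>)
  have I: "right_ideal R I"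
  proof (rule right_idealI)
    show "y \<otimes> s \<in> I" if y: "y \<in> I" and s: "s \<in> carrier R" for y s
    proof -
      have "y \<otimes> s \<otimes> x = \<zero>" if x: "x \<in> J" for x
        using y s Jc[OF x] Jl[OF x s] Jc by (simp add: I_def m_assoc)
      then show ?thesis using y s right_idealD(4)[OF J] by (simp add: I_def)
    qed
  qed (use right_idealD[OF J] in \<open>auto simp: I_def l_distr\<close>)
  have "ideal I R"
  proof (rule idealI[OF ring_axioms])
    show "subgroup I (add_monoid R)"
      using I by (simp add: right_ideal_def additive_subgroup.a_subgroup)
    fix y s assume y: "y \<in> I" and s: "s \<in> carrier R"
    show "y \<otimes> s \<in> I" by (rule right_idealD(4)[OF I y s])
    have "s \<otimes> y \<otimes> x = \<zero>" if x: "x \<in> J" for x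
      using x y s Jc[OF x] Jc by (simp add: I_def m_assoc)
    then show "s \<otimes> y \<in> I" using y s Jl by (simp add: I_def)
  qed
  moreover have "I [^]\<^bsub>ideals_set R\<^esub> (2::nat) = {\<zero>}"
  proof -
    have "I [^]\<^bsub>ideals_set R\<^esub> (2::nat) = ideal_prod R (ideal_prod R (carrier R) I) I"
      by (simp add: nat_pow_def ideals_set_def numeral_2_eq_2)
    also have "ideal_prod R (carrier R) I = I"
    proof
      show "ideal_prod R (carrier R) I \<subseteq> I"
      proof
        fix z assume "z \<in> ideal_prod R (carrier R) I"
        then show "z \<in> I"
          by induct (use \<open>ideal I R\<close> right_idealD(3)[OF I] in \<open>auto intro: ideal.I_l_closed\<close>)
      qed
      show "I \<subseteq> ideal_prod R (carrier R) I"
      proof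
        fix z assume "z \<in> I"
        then show "z \<in> ideal_prod R (carrier R) I"
          using ideal_prod.prod[OF one_closed, of z I R] right_idealD(1)[OF I] by simp
      qed
    qed
    also have "ideal_prod R I I = {\<zero>}"
    proof
      show "ideal_prod R I I \<subseteq> {\<zero>}"
      proof
        fix z assume "z \<in> ideal_prod R I I"
        then show "z \<in> {\<zero>}" by induct (auto simp: I_def)
      qed
      have "\<zero> \<otimes> \<zero> \<in> ideal_prod R I I"
        by (rule ideal_prod.prod[OF right_idealD(2)[OF I] right_idealD(2)[OF I]])
      then show "{\<zero>} \<subseteq> ideal_prod R I I" by simp
    qed
    finally show ?thesis .
  qed
  ultimately have "I = {\<zero>}"
    using semiprime unfolding semiprime_ring_def nilpotent_ideal_def by blast
  moreover have "a \<in> I"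
  proof -
    have "a \<otimes> x = \<zero>" if x: "x \<in> J" for x
    proof -
      have "a \<otimes> \<one> \<otimes> x = \<zero>" using x one_closed unfolding J_def by blast
      then show ?thesis using a by simp
    qed
    moreover have "a \<in> J" using a aRa by (simp add: J_def)
    ultimately show ?thesis by (simp add: I_def)
  qed
  ultimately show ?thesis by blast
qed

text \<open>
  From \<open>a = a(ba)\<close> with \<open>ba \<in> I\<close>, induction puts \<open>a \<in> I\<close> into every power of \<open>I\<close>.
\<close>

lemma von_neumann_regular_semiprime:
  assumes "von_neumann_regular R" shows "semiprime_ring R"
  unfolding semiprime_ring_def nilpotent_ideal_def
proof (intro allI impI, elim conjE exE)
  fix I and n :: nat assume I: "ideal I R" and n: "I [^]\<^bsub>ideals_set R\<^esub> n = {\<zero>}"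
  have "a = \<zero>" if a: "a \<in> I" for a
  proof -
    have ac: "a \<in> carrier R" by (rule ideal.Icarr[OF I a])
    then obtain b where b: "b \<in> carrier R" "a = a \<otimes> b \<otimes> a"
      using assms unfolding von_neumann_regular_def by blast
    have ba: "b \<otimes> a \<in> I" by (rule ideal.I_l_closed[OF I a b(1)])
    have "a \<in> I [^]\<^bsub>ideals_set R\<^esub> k" for k :: nat
    proof (induction k)
      case 0
      then show ?case using ac by (simp add: nat_pow_def ideals_set_def)
    next
      case (Suc k)
      have "a \<otimes> (b \<otimes> a) \<in> ideal_prod R (I [^]\<^bsub>ideals_set R\<^esub> k) I"
        by (rule ideal_prod.prod[OF Suc ba])
      then show ?case using b ac by (simp add: m_assoc nat_pow_def ideals_set_def)
    qed
    then show ?thesis using n by blast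
  qed
  then show "I = {\<zero>}" using additive_subgroup.zero_closed[OF ideal.axioms(1)[OF I]] by blast
qed

end

text \<open>
  The property of right a-rings from which their regularity is deduced. It mentions no module, so
  the type in which injective envelopes live does not occur in it.
\<close>

locale rigid_ring = ring R for R :: "('a, 'r) ring_scheme" (structure) +
  assumes extend: "\<lbrakk>partial_iso R S; essential_right_ideal R (Domain S);
      essential_right_ideal R (Range S)\<rbrakk> \<Longrightarrow>
    \<exists>u\<in>carrier R. (\<forall>x y. (x, y) \<in> S \<longrightarrow> u \<otimes> x = y) \<and>
      (\<forall>I z. essential_right_ideal R I \<longrightarrow> z \<in> I \<longrightarrow> u \<otimes> z \<in> I)"
begin

text \<open>
  Left multiplication by \<open>1 + w\<close> is the identity on the essential annihilator of \<open>w\<close>. Hence it is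
  injective with essential range, and it preserves \<open>I\<close>.
\<close>

lemma singular_preserves_essential:
  assumes w: "w \<in> carrier R" and ess: "essential_right_ideal R (right_annihilator R w)"
    and I: "essential_right_ideal R I" and z: "z \<in> I"
  shows "w \<otimes> z \<in> I"
proof -
  define S where "S = {(x, (\<one> \<oplus> w) \<otimes> x) | x. x \<in> carrier R}"
  have S: "partial_iso R S"
    unfolding S_def
  proof (rule partial_iso_mult)
    show "\<one> \<oplus> w \<in> carrier R" using w by simp
    show "right_ideal R (carrier R)" by (rule right_ideal_carrier[OF ring_axioms])
    fix x assume x: "x \<in> carrier R" "(\<one> \<oplus> w) \<otimes> x = \<zero>"
    show "x = \<zero>"
    proof (rule ccontr)
      assume "x \<noteq> \<zero>"
      then obtain r where r: "r \<in> carrier R" "w \<otimes> (x \<otimes> r) = \<zero>" "x \<otimes> r \<noteq> \<zero>"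
        using essential_right_idealD(2)[OF ess x(1)] by (auto simp: right_annihilator_def)
      have "(\<one> \<oplus> w) \<otimes> x \<otimes> r = x \<otimes> r"
        using w x(1) r by (simp add: l_distr m_assoc)
      then show False using x(2) r by simp
    qed
  qed
  have dom: "Domain S = carrier R" by (auto simp: S_def)
  have "right_annihilator R w \<subseteq> Range S"
  proof
    fix l assume "l \<in> right_annihilator R w"
    then have "(l, (\<one> \<oplus> w) \<otimes> l) \<in> S" "(\<one> \<oplus> w) \<otimes> l = l"
      using w by (auto simp: S_def right_annihilator_def l_distr)
    then show "l \<in> Range S" by force
  qed
  then have ran: "essential_right_ideal R (Range S)"
    by (rule essential_right_ideal_mono[OF ess partial_iso_Range[OF S]])
  obtain u where u: "u \<in> carrier R" "\<And>x y. (x, y) \<in> S \<Longrightarrow> u \<otimes> x = y"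
    and inv: "\<And>I z. \<lbrakk>essential_right_ideal R I; z \<in> I\<rbrakk> \<Longrightarrow> u \<otimes> z \<in> I"
    using extend[OF S _ ran] essential_right_ideal_carrier dom by auto
  have zc: "z \<in> carrier R" by (rule right_idealD(1)[OF essential_right_idealD(1)[OF I] z])
  have "u \<otimes> z = (\<one> \<oplus> w) \<otimes> z" using u(2) zc by (auto simp: S_def)
  then have "u \<otimes> z \<ominus> z = w \<otimes> z" using w zc by (simp add: l_distr minus_eq a_ac r_neg2 r_neg)
  then show ?thesis
    using right_idealD(6)[OF essential_right_idealD(1)[OF I] inv[OF I z] z] by simp
qed

text \<open>
  With \<open>K\<close> the annihilator of a singular \<open>w \<noteq> 0\<close>, there is \<open>s\<close> with \<open>0 \<noteq> a = ws \<in> K\<close>. Every singular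
  \<open>z\<close> satisfies \<open>zK \<subseteq> K\<close>, that is, \<open>wzK = 0\<close>. The product \<open>a r a r' a\<close> has the form \<open>w z a\<close>
  with \<open>z = s r w s r'\<close> singular, so it vanishes; applying semiprimeness twice gives \<open>a = 0\<close>.
\<close>

lemma semiprime_nonsingular:
  assumes semiprime: "semiprime_ring R" and w: "w \<in> carrier R"
    and L: "essential_right_ideal R L" and wL: "\<And>l. l \<in> L \<Longrightarrow> w \<otimes> l = \<zero>"
  shows "w = \<zero>"
proof (rule ccontr)
  assume "w \<noteq> \<zero>"
  let ?K = "right_annihilator R w"
  have "L \<subseteq> ?K"
    using wL right_idealD(1)[OF essential_right_idealD(1)[OF L]]
    by (auto simp: right_annihilator_def)
  then have K: "essential_right_ideal R ?K"
    by (rule essential_right_ideal_mono[OF L right_ideal_annihilator[OF w]])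
  obtain s where s: "s \<in> carrier R" "w \<otimes> s \<in> ?K" "w \<otimes> s \<noteq> \<zero>"
    using essential_right_idealD(2)[OF K w \<open>w \<noteq> \<zero>\<close>] by blast
  define a where "a = w \<otimes> s"
  have a: "a \<in> carrier R" "a \<in> ?K" "a \<noteq> \<zero>" using s w by (auto simp: a_def)
  have aaa: "a \<otimes> r \<otimes> a \<otimes> r' \<otimes> a = \<zero>" if r: "r \<in> carrier R" "r' \<in> carrier R" for r r'
  proof -
    define z where "z = s \<otimes> r \<otimes> (w \<otimes> (s \<otimes> r'))"
    have z: "z \<in> carrier R" using s w r by (simp add: z_def)
    have "{x \<in> carrier R. (s \<otimes> r') \<otimes> x \<in> ?K} \<subseteq> right_annihilator R z"
      using s w r by (auto simp: right_annihilator_def z_def m_assoc)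
    moreover have "essential_right_ideal R {x \<in> carrier R. (s \<otimes> r') \<otimes> x \<in> ?K}"
      using essential_right_ideal_quotient[OF K] s r by simp
    ultimately have "essential_right_ideal R (right_annihilator R z)"
      using essential_right_ideal_mono right_ideal_annihilator[OF z] by blast
    then have "z \<otimes> a \<in> ?K" by (rule singular_preserves_essential[OF z _ K a(2)])
    then have "w \<otimes> (z \<otimes> a) = \<zero>" by (simp add: right_annihilator_def)
    moreover have "a \<otimes> r \<otimes> a \<otimes> r' \<otimes> a = w \<otimes> (z \<otimes> a)"
      using s w r by (simp add: z_def a_def m_assoc)
    ultimately show ?thesis by simp
  qed
  have "a \<otimes> r \<otimes> a = \<zero>" if r: "r \<in> carrier R" for r
  proof (rule semiprime_ring_element[OF semiprime])
    show "a \<otimes> r \<otimes> a \<in> carrier R" using a r by simp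
    fix r' assume r': "r' \<in> carrier R"
    have "a \<otimes> r \<otimes> a \<otimes> r' \<otimes> (a \<otimes> r \<otimes> a) = a \<otimes> r \<otimes> a \<otimes> r' \<otimes> a \<otimes> (r \<otimes> a)"
      using a r r' by (simp add: m_assoc)
    then show "a \<otimes> r \<otimes> a \<otimes> r' \<otimes> (a \<otimes> r \<otimes> a) = \<zero>" using aaa[OF r r'] a r by simp
  qed
  then have "a = \<zero>" by (rule semiprime_ring_element[OF semiprime a(1)])
  then show False using a(3) by simp
qed

text \<open>
  Here \<open>n\<close> arises as \<open>u - 1\<close>, where \<open>u\<close> extends the map \<open>x + z \<mapsto> x + \<theta>x + z\<close> on the essential
  right ideal \<open>Domain S \<oplus> Z\<close>, with \<open>\<theta>\<close> the isomorphism whose graph is \<open>S\<close>.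
\<close>

lemma extend_shear:
  assumes S: "partial_iso R S" and Z: "right_ideal R Z"
    and dis: "Domain S \<inter> Z = {\<zero>}" and ess: "essential_right_ideal R (Domain S <+> Z)"
    and ran: "Range S \<subseteq> Z"
  obtains n where "n \<in> carrier R" "\<And>x y. (x, y) \<in> S \<Longrightarrow> n \<otimes> x = y" "\<And>z. z \<in> Z \<Longrightarrow> n \<otimes> z = \<zero>"
    "\<And>I z. \<lbrakk>essential_right_ideal R I; z \<in> I\<rbrakk> \<Longrightarrow> n \<otimes> z \<in> I"
proof -
  note Sc = partial_isoD(1,2)[OF S] and Zc = right_idealD(1)[OF Z]
  define G where "G = {(x, x \<oplus> y) | x y. (x, y) \<in> S}"
  have GZ: "x = \<zero>" if xy: "(x, y) \<in> S" "x \<oplus> y \<in> Z" for x y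
  proof -
    have "x = (x \<oplus> y) \<ominus> y" using Sc[OF xy(1)] by (simp add: minus_eq a_assoc r_neg)
    moreover have "(x \<oplus> y) \<ominus> y \<in> Z" using right_idealD(6)[OF Z xy(2)] ran xy(1) by blast
    ultimately show ?thesis using dis xy(1) by auto
  qed
  have G: "partial_iso R G"
  proof (rule partial_isoI)
    show "(\<zero>, \<zero>) \<in> G" using partial_isoD(3)[OF S] by (force simp: G_def)
    fix x v assume "(x, v) \<in> G"
    then obtain y where y: "(x, y) \<in> S" "v = x \<oplus> y" by (auto simp: G_def)
    show "x \<in> carrier R \<and> v \<in> carrier R" using Sc[OF y(1)] y(2) by simp
    show "x = \<zero> \<longleftrightarrow> v = \<zero>"
    proof
      assume "x = \<zero>" then show "v = \<zero>" using y partial_isoD(6)[OF S y(1)] by simp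
    next
      assume "v = \<zero>" then show "x = \<zero>" using GZ[OF y(1)] y(2) right_idealD(2)[OF Z] by simp
    qed
    show "(x \<otimes> r, v \<otimes> r) \<in> G" if r: "r \<in> carrier R" for r
      using partial_isoD(5)[OF S y(1) r] Sc[OF y(1)] y(2) r by (auto simp: G_def l_distr)
    fix x' v' assume "(x', v') \<in> G"
    then obtain y' where y': "(x', y') \<in> S" "v' = x' \<oplus> y'" by (auto simp: G_def)
    have "v \<oplus> v' = (x \<oplus> x') \<oplus> (y \<oplus> y')"
      using Sc[OF y(1)] Sc[OF y'(1)] y(2) y'(2) by (simp add: a_ac)
    then show "(x \<oplus> x', v \<oplus> v') \<in> G"
      using partial_isoD(4)[OF S y(1) y'(1)] by (auto simp: G_def)
  qed
  have domG: "Domain G = Domain S" by (auto simp: G_def)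
  have "v = \<zero>" if v: "v \<in> Range G" "v \<in> Z" for v
  proof -
    obtain x y where xy: "(x, y) \<in> S" "v = x \<oplus> y" using v(1) by (auto simp: G_def)
    have x: "x = \<zero>" using GZ[OF xy(1)] v(2) xy(2) by simp
    then show ?thesis using xy partial_isoD(6)[OF S xy(1)] by simp
  qed
  then have ranG: "Range G \<inter> Z = {\<zero>}"
    using right_idealD(2)[OF partial_iso_Range[OF G]] right_idealD(2)[OF Z] by blast
  define P where "P = {(x \<oplus> x', y \<oplus> y') | x y x' y'. (x, y) \<in> G \<and> (x', y') \<in> Id_on Z}"
  have dZ: "Domain G \<inter> Domain (Id_on Z) = {\<zero>}" and rZ: "Range G \<inter> Range (Id_on Z) = {\<zero>}"
    using dis ranG domG by simp_all
  note P = partial_iso_sum[OF G partial_iso_Id_on[OF Z] dZ rZ, folded P_def]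
  have domP: "essential_right_ideal R (Domain P)" using P(2) domG ess by simp
  have "Domain S <+> Z \<subseteq> Range P"
  proof
    fix t assume "t \<in> Domain S <+> Z"
    then obtain x z where xz: "x \<in> Domain S" "z \<in> Z" "t = x \<oplus> z" by (rule set_add_memE)
    then obtain y where y: "(x, y) \<in> S" by blast
    have "y \<in> Z" using ran y by blast
    have "y \<oplus> (z \<ominus> y) = z"
      using Sc[OF y] Zc[OF xz(2)] by (simp add: minus_eq a_lcomm[of y z] r_neg)
    then have "t = (x \<oplus> y) \<oplus> (z \<ominus> y)"
      using Sc[OF y] Zc[OF xz(2)] xz(3) by (simp add: a_assoc)
    moreover have "x \<oplus> y \<in> Range G" using y by (auto simp: G_def)
    ultimately show "t \<in> Range P"
      using set_add_memI[of _ "Range G" _ Z] right_idealD(6)[OF Z xz(2) \<open>y \<in> Z\<close>] P(3) by simp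
  qed
  then have ranP: "essential_right_ideal R (Range P)"
    by (rule essential_right_ideal_mono[OF ess partial_iso_Range[OF P(1)]])
  obtain u where u: "u \<in> carrier R" "\<And>x y. (x, y) \<in> P \<Longrightarrow> u \<otimes> x = y"
    and inv: "\<And>I z. \<lbrakk>essential_right_ideal R I; z \<in> I\<rbrakk> \<Longrightarrow> u \<otimes> z \<in> I"
    using extend[OF P(1) domP ranP] by blast
  have sub: "(u \<ominus> \<one>) \<otimes> z = u \<otimes> z \<ominus> z" if "z \<in> carrier R" for z
    using that u(1) by (simp add: minus_eq l_distr l_minus)
  show ?thesis
  proof (rule that)
    show "u \<ominus> \<one> \<in> carrier R" using u(1) by simp
    show "(u \<ominus> \<one>) \<otimes> x = y" if xy: "(x, y) \<in> S" for x y
    proof -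
      have "(x, x \<oplus> y) \<in> P" using P(4) xy by (auto simp: G_def)
      then have "u \<otimes> x = x \<oplus> y" by (rule u(2))
      then show ?thesis
        using sub Sc[OF xy] by (simp add: minus_eq a_assoc a_lcomm[of x y] r_neg)
    qed
    show "(u \<ominus> \<one>) \<otimes> z = \<zero>" if z: "z \<in> Z" for z
    proof -
      have "u \<otimes> z = z" using P(5) z by (intro u(2)) auto
      then show ?thesis using sub Zc[OF z] by (simp add: minus_eq r_neg)
    qed
    show "(u \<ominus> \<one>) \<otimes> z \<in> I" if I: "essential_right_ideal R I" and z: "z \<in> I" for I z
      using right_idealD(6)[OF essential_right_idealD(1)[OF I] inv[OF I z] z]
        right_idealD(1)[OF essential_right_idealD(1)[OF I] z] sub by simp
  qed
qed

end

section \<open>Right ideals that occur twice\<close>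

locale nonsingular_rigid_ring = rigid_ring +
  assumes nonsingular:
    "\<lbrakk>w \<in> carrier R; essential_right_ideal R L; \<And>l. l \<in> L \<Longrightarrow> w \<otimes> l = \<zero>\<rbrakk> \<Longrightarrow> w = \<zero>"
begin

lemma eq_on_essential:
  assumes "x \<in> carrier R" "y \<in> carrier R" and L: "essential_right_ideal R L"
    and eq: "\<And>l. l \<in> L \<Longrightarrow> x \<otimes> l = y \<otimes> l"
  shows "x = y"
proof -
  have "(x \<ominus> y) \<otimes> l = \<zero>" if l: "l \<in> L" for l
    using eq[OF l] assms(1,2) right_idealD(1)[OF essential_right_idealD(1)[OF L] l]
    by (simp add: minus_eq l_distr l_minus r_neg)
  then have "x \<ominus> y = \<zero>" using nonsingular[OF _ L] assms(1,2) by simp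
  then show ?thesis using diff_eq_zeroD assms(1,2) by blast
qed

text \<open>
  Let \<open>X = Domain S\<close>, \<open>Y = Range S\<close>, and let \<open>C\<close> be a complement of \<open>X \<oplus> Y\<close>. The isomorphism and
  its inverse, extended by zero to the other summands, are left multiplications by \<open>n\<close> and \<open>m\<close>, and
  \<open>f = mn\<close> is idempotent and fixes \<open>X\<close>. A priori \<open>fR\<close> is only an essential extension of \<open>X\<close>. But
  \<open>m\<close> preserves the essential right ideal \<open>X + nR + C\<close>, which contains \<open>n\<close>, and applying \<open>f\<close> to
  \<open>f = mn \<in> X + nR + C\<close> leaves only the component in \<open>X\<close>.
\<close>

lemma repeated_right_ideal:
  assumes S: "partial_iso R S" and dis: "Domain S \<inter> Range S = {\<zero>}"
  obtains f m where "f \<in> Domain S" "\<And>x. x \<in> Domain S \<Longrightarrow> f \<otimes> x = x"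
    "m \<in> carrier R" "\<And>x y. (x, y) \<in> S \<Longrightarrow> m \<otimes> y = x"
proof -
  let ?X = "Domain S" and ?Y = "Range S"
  note Sc = partial_isoD(1,2)[OF S]
  have X: "right_ideal R ?X" and Y: "right_ideal R ?Y"
    by (rule partial_iso_Domain[OF S], rule partial_iso_Range[OF S])
  note XY = right_ideal_sum[OF X Y]
  obtain C where C: "right_ideal R C" "(?X <+> ?Y) \<inter> C = {\<zero>}"
    and ess: "essential_right_ideal R ((?X <+> ?Y) <+> C)"
    by (rule complement_exists[OF XY])
  note Xc = right_idealD(1)[OF X] and Yc = right_idealD(1)[OF Y] and Cc = right_idealD(1)[OF C(1)]
  have indep: "x = \<zero> \<and> y = \<zero> \<and> c = \<zero>"
    if "x \<in> ?X" "y \<in> ?Y" "c \<in> C" "x \<oplus> y = c" for x y c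
  proof -
    have "c \<in> ?X <+> ?Y" using set_add_memI[OF that(1,2)] that(4) by simp
    then have c: "c = \<zero>" using C(2) that(3) by blast
    then have "x = \<ominus> y"
      using that(4) Xc[OF that(1)] Yc[OF that(2)] by (simp add: minus_equality)
    then have "x \<in> ?Y" using right_idealD(5)[OF Y that(2)] by simp
    then have "x = \<zero>" using dis that(1) by blast
    then show ?thesis using c that(4) Yc[OF that(2)] by simp
  qed
  have X_YC: "?X \<inter> (?Y <+> C) = {\<zero>}"
  proof -
    have "x = \<zero>" if x: "x \<in> ?X" "x \<in> ?Y <+> C" for x
    proof -
      obtain y c where yc: "y \<in> ?Y" "c \<in> C" "x = y \<oplus> c" using x(2) by (rule set_add_memE)
      have "x \<oplus> \<ominus> y = c"
        using yc Yc[OF yc(1)] Cc[OF yc(2)] by (simp add: a_ac r_neg2 a_lcomm[of y c] r_neg)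
      then show ?thesis using indep[OF x(1) right_idealD(5)[OF Y yc(1)] yc(2)] by blast
    qed
    then show ?thesis
      using right_idealD(2)[OF X] right_idealD(2)[OF right_ideal_sum[OF Y C(1)]] by blast
  qed
  have Y_XC: "?Y \<inter> (?X <+> C) = {\<zero>}"
  proof -
    have "y = \<zero>" if y: "y \<in> ?Y" "y \<in> ?X <+> C" for y
    proof -
      obtain x c where xc: "x \<in> ?X" "c \<in> C" "y = x \<oplus> c" using y(2) by (rule set_add_memE)
      have "\<ominus> x \<oplus> y = c"
        using xc Xc[OF xc(1)] Cc[OF xc(2)] by (simp add: r_neg1)
      then show ?thesis using indep[OF right_idealD(5)[OF X xc(1)] y(1) xc(2)] by blast
    qed
    then show ?thesis
      using right_idealD(2)[OF Y] right_idealD(2)[OF right_ideal_sum[OF X C(1)]] by blast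
  qed
  define I where "I = (?X <+> ?Y) <+> C"
  have Ielim: thesis
    if "z \<in> I" "\<And>x y c. \<lbrakk>x \<in> ?X; y \<in> ?Y; c \<in> C; z = x \<oplus> y \<oplus> c\<rbrakk> \<Longrightarrow> thesis" for z thesis
    using that by (auto simp: I_def elim!: set_add_memE)
  have I: "essential_right_ideal R I" using ess by (simp add: I_def)
  have "I \<subseteq> ?X <+> (?Y <+> C)"
  proof
    fix z assume "z \<in> I"
    then obtain x y c where *: "x \<in> ?X" "y \<in> ?Y" "c \<in> C" "z = x \<oplus> y \<oplus> c" by (rule Ielim)
    then have "z = x \<oplus> (y \<oplus> c)" using Xc Yc Cc by (simp add: a_assoc)
    then show "z \<in> ?X <+> (?Y <+> C)" using set_add_memI[OF *(1) set_add_memI[OF *(2,3)]] by simp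
  qed
  then have ess1: "essential_right_ideal R (?X <+> (?Y <+> C))"
    by (rule essential_right_ideal_mono[OF I right_ideal_sum[OF X right_ideal_sum[OF Y C(1)]]])
  have "I \<subseteq> ?Y <+> (?X <+> C)"
  proof
    fix z assume "z \<in> I"
    then obtain x y c where *: "x \<in> ?X" "y \<in> ?Y" "c \<in> C" "z = x \<oplus> y \<oplus> c" by (rule Ielim)
    then have "z = y \<oplus> (x \<oplus> c)" using Xc Yc Cc by (simp add: a_ac)
    then show "z \<in> ?Y <+> (?X <+> C)" using set_add_memI[OF *(2) set_add_memI[OF *(1,3)]] by simp
  qed
  then have ess2: "essential_right_ideal R (?Y <+> (?X <+> C))"
    by (rule essential_right_ideal_mono[OF I right_ideal_sum[OF Y right_ideal_sum[OF X C(1)]]])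
  obtain n where n: "n \<in> carrier R" "\<And>x y. (x, y) \<in> S \<Longrightarrow> n \<otimes> x = y"
    and nYC: "\<And>z. z \<in> ?Y <+> C \<Longrightarrow> n \<otimes> z = \<zero>"
    and "\<And>I z. \<lbrakk>essential_right_ideal R I; z \<in> I\<rbrakk> \<Longrightarrow> n \<otimes> z \<in> I"
    by (rule extend_shear[OF S right_ideal_sum[OF Y C(1)] X_YC ess1
          right_ideal_sum_upper(1)[OF Y C(1)]]) (rule that)
  have conv: "Domain (S\<inverse>) \<inter> (?X <+> C) = {\<zero>}" "Range (S\<inverse>) \<subseteq> ?X <+> C"
    "essential_right_ideal R (Domain (S\<inverse>) <+> (?X <+> C))"
    using Y_XC right_ideal_sum_upper(1)[OF X C(1)] ess2 by simp_all
  obtain m where m: "m \<in> carrier R" and mS: "\<And>y x. (y, x) \<in> S\<inverse> \<Longrightarrow> m \<otimes> y = x"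
    and "\<And>z. z \<in> ?X <+> C \<Longrightarrow> m \<otimes> z = \<zero>"
    and mI: "\<And>I z. \<lbrakk>essential_right_ideal R I; z \<in> I\<rbrakk> \<Longrightarrow> m \<otimes> z \<in> I"
    by (rule extend_shear[OF partial_iso_converse[OF S] right_ideal_sum[OF X C(1)]
          conv(1,3,2)]) (rule that)
  have mS: "m \<otimes> y = x" if "(x, y) \<in> S" for x y using mS that by simp
  have nY: "n \<otimes> y = \<zero>" if "y \<in> ?Y" for y
    using nYC right_ideal_sum_upper(1)[OF Y C(1)] that by blast
  have nC: "n \<otimes> c = \<zero>" if "c \<in> C" for c
    using nYC right_ideal_sum_upper(2)[OF Y C(1)] that by blast
  define f where "f = m \<otimes> n"
  have f: "f \<in> carrier R" using m n by (simp add: f_def)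
  have fX: "f \<otimes> x = x" if "x \<in> ?X" for x
  proof -
    obtain y where y: "(x, y) \<in> S" using \<open>x \<in> ?X\<close> by blast
    then show ?thesis using m n mS Sc[OF y] by (simp add: f_def m_assoc)
  qed
  have fY: "f \<otimes> y = \<zero>" if "y \<in> ?Y" for y
    using nY[OF that] m n Yc[OF that] by (simp add: f_def m_assoc)
  have fC: "f \<otimes> c = \<zero>" if "c \<in> C" for c
    using nC[OF that] m n Cc[OF that] by (simp add: f_def m_assoc)
  have nn: "n \<otimes> n = \<zero>"
  proof (rule nonsingular[OF _ I])
    show "n \<otimes> n \<in> carrier R" using n by simp
    fix z assume "z \<in> I"
    then obtain x y c where *: "x \<in> ?X" "y \<in> ?Y" "c \<in> C" "z = x \<oplus> y \<oplus> c" by (rule Ielim)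
    obtain y' where y': "(x, y') \<in> S" using *(1) by blast
    have "n \<otimes> z = y'"
      using * Xc[OF *(1)] Yc[OF *(2)] Cc[OF *(3)] n y' nY nC Sc[OF y'] by (simp add: r_distr)
    then have "n \<otimes> (n \<otimes> z) = \<zero>" using nY y' by blast
    then show "n \<otimes> n \<otimes> z = \<zero>"
      using * Xc[OF *(1)] Yc[OF *(2)] Cc[OF *(3)] n by (simp add: m_assoc)
  qed
  have ff: "f \<otimes> f = f"
  proof (rule eq_on_essential[OF _ f I])
    show "f \<otimes> f \<in> carrier R" using f by simp
    fix z assume "z \<in> I"
    then obtain x y c where *: "x \<in> ?X" "y \<in> ?Y" "c \<in> C" "z = x \<oplus> y \<oplus> c" by (rule Ielim)
    have "f \<otimes> z = x"
      using * Xc[OF *(1)] Yc[OF *(2)] Cc[OF *(3)] f fX fY fC by (simp add: r_distr)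
    then show "f \<otimes> f \<otimes> z = f \<otimes> z"
      using * Xc[OF *(1)] Yc[OF *(2)] Cc[OF *(3)] f fX by (simp add: m_assoc)
  qed
  let ?nR = "(\<otimes>) n ` carrier R"
  have nR: "right_ideal R ?nR" by (rule right_ideal_principal[OF n(1)])
  \<comment> \<open>It remains to see \<open>f \<in> X\<close>, by invariance of an essential right ideal in which \<open>X\<close> is not yet enlarged to \<open>fR\<close>.\<close>
  define J where "J = (?X <+> ?nR) <+> C"
  have Jr: "right_ideal R J"
    unfolding J_def by (rule right_ideal_sum[OF right_ideal_sum[OF X nR] C(1)])
  have "I \<subseteq> J"
  proof
    fix z assume "z \<in> I"
    then obtain x y c where *: "x \<in> ?X" "y \<in> ?Y" "c \<in> C" "z = x \<oplus> y \<oplus> c" by (rule Ielim)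
    obtain x' where "(x', y) \<in> S" using *(2) by blast
    then have "y \<in> ?nR" using n(2) Sc by force
    then show "z \<in> J" using *(4) set_add_memI[OF set_add_memI[OF *(1)] *(3)] by (simp add: J_def)
  qed
  then have J: "essential_right_ideal R J" by (rule essential_right_ideal_mono[OF I Jr])
  have "n \<in> ?nR" using n by (intro image_eqI[of _ _ \<one>]) auto
  then have "n \<in> J"
    using right_ideal_sum_upper[OF X nR] right_ideal_sum_upper[OF right_ideal_sum[OF X nR] C(1)]
    by (auto simp: J_def)
  then have "f \<in> J" unfolding f_def by (rule mI[OF J])
  then obtain x s c where fx: "x \<in> ?X" "s \<in> carrier R" "c \<in> C" "f = x \<oplus> n \<otimes> s \<oplus> c"
    by (auto simp: J_def elim!: set_add_memE)
  have "f \<otimes> (n \<otimes> s) = m \<otimes> (n \<otimes> n \<otimes> s)" using m n fx(2) by (simp add: f_def m_assoc)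
  then have "f \<otimes> (n \<otimes> s) = \<zero>" using nn m fx(2) by simp
  moreover have "f \<otimes> (x \<oplus> n \<otimes> s \<oplus> c) = f \<otimes> x \<oplus> f \<otimes> (n \<otimes> s) \<oplus> f \<otimes> c"
    using f n Xc[OF fx(1)] Cc[OF fx(3)] fx(2) by (simp add: r_distr)
  ultimately have "f \<otimes> f = x" using fx(4) fX[OF fx(1)] fC[OF fx(3)] Xc[OF fx(1)] by simp
  then have "f \<in> ?X" using ff fx(1) by simp
  then show ?thesis by (rule that[OF _ fX m mS])
qed

text \<open>
  Split \<open>W\<close> into \<open>W \<inter> X\<close> and a complement \<open>W2\<close>, where \<open>X = Domain S\<close> and \<open>Y = Range S\<close>. The first
  part occurs a second time inside \<open>Y\<close>. The second part meets \<open>X\<close> trivially, and the projection to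
  \<open>Y\<close> followed by the isomorphism \<open>Y \<cong> X\<close> embeds it into \<open>X\<close>, so it too occurs twice. Hence both
  parts are generated by idempotents \<open>p1\<close> and \<open>p2\<close>, which are then combined.
\<close>

lemma repeated_submodule_summand:
  assumes S: "partial_iso R S" and dis: "Domain S \<inter> Range S = {\<zero>}"
    and W: "right_ideal R W" and sub: "W \<subseteq> Domain S <+> Range S"
  obtains p where "p \<in> W" "\<And>w. w \<in> W \<Longrightarrow> p \<otimes> w = w"
proof -
  let ?X = "Domain S" and ?Y = "Range S"
  note Sc = partial_isoD(1,2)[OF S] and Wc = right_idealD(1)[OF W]
  have X: "right_ideal R ?X" and Y: "right_ideal R ?Y"
    by (rule partial_iso_Domain[OF S], rule partial_iso_Range[OF S])
  define S1 where "S1 = {(x, y) \<in> S. x \<in> W}"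
  have S1: "partial_iso R S1" unfolding S1_def by (rule partial_iso_restrict[OF S W])
  have "Domain S1 \<inter> Range S1 \<subseteq> {\<zero>}" using dis by (auto simp: S1_def)
  then have dis1: "Domain S1 \<inter> Range S1 = {\<zero>}"
    using right_idealD(2)[OF partial_iso_Domain[OF S1]] right_idealD(2)[OF partial_iso_Range[OF S1]]
    by blast
  obtain p1 where "p1 \<in> Domain S1" "\<And>w. w \<in> Domain S1 \<Longrightarrow> p1 \<otimes> w = w"
    using repeated_right_ideal[OF S1 dis1] by metis
  moreover have "Domain S1 = ?X \<inter> W" by (auto simp: S1_def)
  ultimately have p1: "p1 \<in> ?X" "p1 \<in> W" "\<And>w. \<lbrakk>w \<in> ?X; w \<in> W\<rbrakk> \<Longrightarrow> p1 \<otimes> w = w" by auto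
  have p1c: "p1 \<in> carrier R" using p1 Wc by blast
  have p1p1: "p1 \<otimes> (p1 \<otimes> w) = p1 \<otimes> w" if "w \<in> carrier R" for w
    using p1(3) right_idealD(4)[OF X p1(1) that] right_idealD(4)[OF W p1(2) that] by blast
  define W2 where "W2 = {w \<in> W. p1 \<otimes> w = \<zero>}"
  have W2X: "w = \<zero>" if "w \<in> W2" "w \<in> ?X" for w
    using that p1(3)[of w] by (simp add: W2_def)
  \<comment> \<open>\<open>P\<close> sends \<open>w = x' + y\<close> to the element of \<open>X\<close> that corresponds to \<open>y\<close>.\<close>
  define P where "P = {(w, x). w \<in> W2 \<and> (\<exists>y. (x, y) \<in> S \<and> w \<ominus> y \<in> ?X)}"
  have W2: "right_ideal R W2"
    by (rule right_idealI)
      (use p1c right_idealD[OF W] in \<open>auto simp: W2_def r_distr m_assoc[symmetric]\<close>)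
  note W2c = right_idealD(1)[OF W2]
  have P: "partial_iso R P"
  proof (rule partial_isoI)
    show "(\<zero>, \<zero>) \<in> P"
      using right_idealD(2)[OF W2] partial_isoD(3)[OF S] by (force simp: P_def minus_eq)
    fix w x assume "(w, x) \<in> P"
    then obtain y where y: "w \<in> W2" "(x, y) \<in> S" "w \<ominus> y \<in> ?X" by (auto simp: P_def)
    note c = W2c[OF y(1)] Sc[OF y(2)]
    show "w \<in> carrier R \<and> x \<in> carrier R" using c by simp
    show "w = \<zero> \<longleftrightarrow> x = \<zero>"
    proof
      assume "w = \<zero>"
      then have "\<ominus> (w \<ominus> y) = y" using c by (simp add: minus_eq)
      then have "y \<in> ?X" using right_idealD(5)[OF X y(3)] by simp
      then have "y = \<zero>" using dis y(2) by blast
      then show "x = \<zero>" using partial_isoD(6)[OF S y(2)] by simp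
    next
      assume "x = \<zero>"
      then have "y = \<zero>" using partial_isoD(6)[OF S y(2)] by simp
      then have "w \<in> ?X" using y(3) c by (simp add: minus_eq)
      then show "w = \<zero>" using W2X y(1) by blast
    qed
    show "(w \<otimes> r, x \<otimes> r) \<in> P" if r: "r \<in> carrier R" for r
    proof -
      have "w \<otimes> r \<ominus> y \<otimes> r = (w \<ominus> y) \<otimes> r" using c r by (simp add: minus_eq l_distr l_minus)
      then have "w \<otimes> r \<ominus> y \<otimes> r \<in> ?X" using right_idealD(4)[OF X y(3) r] by simp
      then show ?thesis
        using right_idealD(4)[OF W2 y(1) r] partial_isoD(5)[OF S y(2) r] unfolding P_def by blast
    qed
    fix w' x' assume "(w', x') \<in> P"
    then obtain y' where y': "w' \<in> W2" "(x', y') \<in> S" "w' \<ominus> y' \<in> ?X" by (auto simp: P_def)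
    note c' = W2c[OF y'(1)] Sc[OF y'(2)]
    have "(w \<oplus> w') \<ominus> (y \<oplus> y') = (w \<ominus> y) \<oplus> (w' \<ominus> y')"
      using c c' by (simp add: minus_eq minus_add a_ac)
    then have "(w \<oplus> w') \<ominus> (y \<oplus> y') \<in> ?X" using right_idealD(3)[OF X y(3) y'(3)] by simp
    then show "(w \<oplus> w', x \<oplus> x') \<in> P"
      using right_idealD(3)[OF W2 y(1) y'(1)] partial_isoD(4)[OF S y(2) y'(2)]
      unfolding P_def by blast
  qed
  have domP: "Domain P = W2"
  proof
    show "Domain P \<subseteq> W2" by (auto simp: P_def)
    show "W2 \<subseteq> Domain P"
    proof
      fix w assume w: "w \<in> W2"
      then have "w \<in> ?X <+> ?Y" using sub by (auto simp: W2_def)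
      then obtain x' y where *: "x' \<in> ?X" "y \<in> ?Y" "w = x' \<oplus> y" by (rule set_add_memE)
      then obtain x where x: "(x, y) \<in> S" by blast
      have "w \<ominus> y = x'"
        using *(3) right_idealD(1)[OF X *(1)] Sc[OF x] by (simp add: minus_eq a_assoc r_neg)
      then have "(w, x) \<in> P" using w x *(1) by (auto simp: P_def)
      then show "w \<in> Domain P" by blast
    qed
  qed
  have "Range P \<subseteq> ?X" by (auto simp: P_def)
  then have "Domain P \<inter> Range P = {\<zero>}"
    using W2X domP right_idealD(2)[OF partial_iso_Domain[OF P]]
      right_idealD(2)[OF partial_iso_Range[OF P]] by blast
  then obtain p2 where "p2 \<in> Domain P" "\<And>w. w \<in> Domain P \<Longrightarrow> p2 \<otimes> w = w"
    using repeated_right_ideal[OF P] by metis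
  then have p2: "p2 \<in> W" "\<And>w. w \<in> W2 \<Longrightarrow> p2 \<otimes> w = w" using domP by (auto simp: W2_def)
  have p2c: "p2 \<in> carrier R" using p2 Wc by blast
  \<comment> \<open>It fixes \<open>w\<close>, since \<open>w = p1 w + (w - p1 w)\<close> and \<open>p2\<close> fixes the second term, which lies in \<open>W2\<close>.\<close>
  show ?thesis
  proof (rule that)
    show "p1 \<oplus> (p2 \<ominus> p2 \<otimes> p1) \<in> W"
      by (rule right_idealD(3)[OF W p1(2) right_idealD(6)[OF W p2(1) right_idealD(4)[OF W p2(1) p1c]]])
    fix w assume w: "w \<in> W"
    note wc = Wc[OF w]
    have "w \<ominus> p1 \<otimes> w \<in> W2"
      using right_idealD(6)[OF W w right_idealD(4)[OF W p1(2) wc]] p1p1[OF wc] p1c wc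
      by (simp add: W2_def minus_eq r_distr r_minus r_neg)
    then have "p2 \<otimes> (w \<ominus> p1 \<otimes> w) = w \<ominus> p1 \<otimes> w" by (rule p2(2))
    moreover have "(p1 \<oplus> (p2 \<ominus> p2 \<otimes> p1)) \<otimes> w = p1 \<otimes> w \<oplus> p2 \<otimes> (w \<ominus> p1 \<otimes> w)"
      using p1c p2c wc by (simp add: minus_eq l_distr r_distr r_minus l_minus m_assoc)
    ultimately show "(p1 \<oplus> (p2 \<ominus> p2 \<otimes> p1)) \<otimes> w = w"
      using p1c wc by (simp add: minus_eq a_lcomm[of "p1 \<otimes> w" w] r_neg)
  qed
qed

text \<open>
  The graph of an isomorphism \<open>T\<close> that is independent of \<open>S\<close> could be added to \<open>S\<close>, so a maximal \<open>S\<close>,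
  which exists by Zorn's lemma, leaves room only for the zero isomorphism.
\<close>

lemma maximal_repetition:
  obtains S where "partial_iso R S" "Domain S \<inter> Range S = {\<zero>}"
    "\<And>T. \<lbrakk>partial_iso R T; Domain T \<inter> Range T = {\<zero>};
        (Domain T <+> Range T) \<inter> (Domain S <+> Range S) = {\<zero>}\<rbrakk> \<Longrightarrow> Domain T = {\<zero>}"
proof -
  define F where "F = {S. partial_iso R S \<and> Domain S \<inter> Range S = {\<zero>}}"
  have "\<exists>S\<in>F. \<forall>T\<in>F. S \<subseteq> T \<longrightarrow> T = S"
  proof (rule subset_Zorn_nonempty)
    have "partial_iso R {(\<zero>, \<zero>)}" by (rule partial_isoI) auto
    then show "F \<noteq> {}" by (auto simp: F_def)
    fix \<C> assume C: "\<C> \<noteq> {}" "subset.chain F \<C>"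
    have iso: "partial_iso R S" and dis: "Domain S \<inter> Range S = {\<zero>}" if "S \<in> \<C>" for S
      using C(2) that by (auto simp: subset.chain_def F_def)
    have common: "\<exists>U\<in>\<C>. p \<in> U \<and> q \<in> U" if "p \<in> \<Union>\<C>" "q \<in> \<Union>\<C>" for p q
      using C(2) that unfolding subset_chain_def by blast
    have "partial_iso R (\<Union>\<C>)"
    proof (rule partial_isoI)
      obtain S where "S \<in> \<C>" using C(1) by blast
      then show "(\<zero>, \<zero>) \<in> \<Union>\<C>" using partial_isoD(3)[OF iso] by blast
      fix x y assume "(x, y) \<in> \<Union>\<C>"
      then obtain S where xy: "S \<in> \<C>" "(x, y) \<in> S" by blast
      show "x \<in> carrier R \<and> y \<in> carrier R" using partial_isoD(1,2)[OF iso[OF xy(1)] xy(2)] by blast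
      show "x = \<zero> \<longleftrightarrow> y = \<zero>" by (rule partial_isoD(6)[OF iso[OF xy(1)] xy(2)])
      show "(x \<otimes> r, y \<otimes> r) \<in> \<Union>\<C>" if "r \<in> carrier R" for r
        using partial_isoD(5)[OF iso[OF xy(1)] xy(2) that] xy(1) by blast
      fix x' y' assume "(x', y') \<in> \<Union>\<C>"
      then obtain U where U: "U \<in> \<C>" "(x, y) \<in> U" "(x', y') \<in> U"
        using common \<open>(x, y) \<in> \<Union>\<C>\<close> by blast
      show "(x \<oplus> x', y \<oplus> y') \<in> \<Union>\<C>" using partial_isoD(4)[OF iso[OF U(1)] U(2,3)] U(1) by blast
    qed
    moreover have "x = \<zero>" if x: "x \<in> Domain (\<Union>\<C>)" "x \<in> Range (\<Union>\<C>)" for x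
    proof -
      obtain y z where "(x, y) \<in> \<Union>\<C>" "(z, x) \<in> \<Union>\<C>" using x by blast
      then obtain U where "U \<in> \<C>" "(x, y) \<in> U" "(z, x) \<in> U" using common by blast
      then show ?thesis using dis[of U] by blast
    qed
    moreover have "\<zero> \<in> Domain (\<Union>\<C>) \<inter> Range (\<Union>\<C>)"
      using partial_isoD(3)[OF \<open>partial_iso R (\<Union>\<C>)\<close>] by blast
    ultimately show "\<Union>\<C> \<in> F" by (auto simp: F_def)
  qed
  then obtain S where SF: "S \<in> F" and max: "\<And>T. \<lbrakk>T \<in> F; S \<subseteq> T\<rbrakk> \<Longrightarrow> T = S" by blast
  have S: "partial_iso R S" and dis: "Domain S \<inter> Range S = {\<zero>}" using SF by (auto simp: F_def)
  note X = partial_iso_Domain[OF S] and Y = partial_iso_Range[OF S]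
  have "Domain T = {\<zero>}" if T: "partial_iso R T" and disT: "Domain T \<inter> Range T = {\<zero>}"
    and far: "(Domain T <+> Range T) \<inter> (Domain S <+> Range S) = {\<zero>}" for T
  proof -
    note D = partial_iso_Domain[OF T] and D' = partial_iso_Range[OF T]
    note upS = right_ideal_sum_upper[OF X Y] and upT = right_ideal_sum_upper[OF D D']
    have zeros: "\<zero> \<in> Domain S" "\<zero> \<in> Range S" "\<zero> \<in> Domain T" "\<zero> \<in> Range T"
      using right_idealD(2) X Y D D' by blast+
    have dom: "Domain S \<inter> Domain T = {\<zero>}" and ran: "Range S \<inter> Range T = {\<zero>}"
      using far upS upT zeros by blast+
    define P where "P = {(x \<oplus> x', y \<oplus> y') | x y x' y'. (x, y) \<in> S \<and> (x', y') \<in> T}"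
    note P = partial_iso_sum[OF S T dom ran, folded P_def]
    have "v = \<zero>" if v: "v \<in> Domain P" "v \<in> Range P" for v
    proof -
      obtain x d where 1: "x \<in> Domain S" "d \<in> Domain T" "v = x \<oplus> d"
        using v(1) unfolding P(2) by (rule set_add_memE)
      obtain y e where 2: "y \<in> Range S" "e \<in> Range T" "v = y \<oplus> e"
        using v(2) unfolding P(3) by (rule set_add_memE)
      note c = right_idealD(1)[OF X 1(1)] right_idealD(1)[OF D 1(2)]
        right_idealD(1)[OF Y 2(1)] right_idealD(1)[OF D' 2(2)]
      have "d \<ominus> e = \<ominus> x \<oplus> (x \<oplus> d) \<oplus> \<ominus> e" using c by (simp add: minus_eq r_neg1)
      also have "\<dots> = \<ominus> x \<oplus> (y \<oplus> e) \<oplus> \<ominus> e" using 1(3) 2(3) by simp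
      also have "\<dots> = \<ominus> x \<oplus> y" using c by (simp add: a_assoc r_neg)
      finally have de: "d \<ominus> e = \<ominus> x \<oplus> y" .
      have "d \<ominus> e \<in> Domain T <+> Range T"
        using set_add_memI[OF 1(2) right_idealD(5)[OF D' 2(2)]] by (simp add: minus_eq)
      moreover have "d \<ominus> e \<in> Domain S <+> Range S"
        using set_add_memI[OF right_idealD(5)[OF X 1(1)] 2(1)] de by simp
      ultimately have "d \<ominus> e = \<zero>" using far by blast
      then have "d = e" using diff_eq_zeroD c by blast
      then have d: "d = \<zero>" using disT 1(2) 2(2) by blast
      then have "x = y" using 1(3) 2(3) \<open>d = e\<close> c by simp
      then have "x = \<zero>" using dis 1(1) 2(1) by blast
      then show ?thesis using 1(3) d by simp
    qed
    then have "Domain P \<inter> Range P = {\<zero>}"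
      using right_idealD(2)[OF partial_iso_Domain[OF P(1)]]
        right_idealD(2)[OF partial_iso_Range[OF P(1)]] by blast
    then have "P \<in> F" using P(1) by (simp add: F_def)
    then have "P = S" using max P(4) by blast
    then have "Domain T \<subseteq> Domain S" using P(5) by blast
    then show ?thesis using dom zeros by blast
  qed
  then show ?thesis using that[OF S dis] by blast
qed

end

section \<open>Regularity\<close>

text \<open>
  This is McCoy's lemma. If \<open>c = a - ata = a(1 - ta) = (1 - at)a\<close> and \<open>c = cyc\<close>, then
  \<open>a = ata + cyc\<close> has \<open>a\<close> as a left and as a right factor.
\<close>

lemma (in ring) regular_if_reduction_regular:
  assumes a: "a \<in> carrier R" and t: "t \<in> carrier R" and c: "c = a \<ominus> a \<otimes> t \<otimes> a"
    and reg: "\<exists>y\<in>carrier R. c = c \<otimes> y \<otimes> c"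
  shows "\<exists>b\<in>carrier R. a = a \<otimes> b \<otimes> a"
proof -
  obtain y where y: "y \<in> carrier R" "c = c \<otimes> y \<otimes> c" using reg by blast
  define p where "p = \<one> \<ominus> t \<otimes> a"
  define q where "q = \<one> \<ominus> a \<otimes> t"
  have pq: "p \<in> carrier R" "q \<in> carrier R" using a t by (simp_all add: p_def q_def)
  have cp: "c = a \<otimes> p" and cq: "c = q \<otimes> a"
    using a t by (simp_all add: c p_def q_def minus_eq r_distr l_distr r_minus l_minus m_assoc)
  have "a = a \<otimes> t \<otimes> a \<oplus> c"
    using a t by (simp add: c minus_eq a_lcomm[of "a \<otimes> t \<otimes> a" a] r_neg)
  also have "c = a \<otimes> p \<otimes> y \<otimes> (q \<otimes> a)" using y(2) cp cq by metis
  also have "a \<otimes> t \<otimes> a \<oplus> a \<otimes> p \<otimes> y \<otimes> (q \<otimes> a) = a \<otimes> (t \<oplus> p \<otimes> y \<otimes> q) \<otimes> a"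
    using a t y(1) pq by (simp add: r_distr l_distr m_assoc)
  finally show ?thesis using t y(1) pq by (intro bexI[of _ "t \<oplus> p \<otimes> y \<otimes> q"]) auto
qed

context nonsingular_rigid_ring
begin

text \<open>
  The hypothesis \<open>free\<close> says that \<open>(1 - g)R\<close> contains no two isomorphic nonzero right ideals with
  zero intersection, so \<open>a\<close> cannot move a right ideal of \<open>(1 - g)R\<close> off itself injectively.
\<close>

lemma repetition_free_regular:
  assumes g: "g \<in> carrier R"
    and free: "\<And>T. \<lbrakk>partial_iso R T; Domain T \<inter> Range T = {\<zero>};
      \<And>z. z \<in> Domain T \<union> Range T \<Longrightarrow> g \<otimes> z = \<zero>\<rbrakk> \<Longrightarrow> Domain T = {\<zero>}"
    and gg: "g \<otimes> g = g"
    and a: "a \<in> carrier R" and ga: "g \<otimes> a = \<zero>" and ag: "a \<otimes> g = \<zero>"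
  shows "\<exists>b\<in>carrier R. a = a \<otimes> b \<otimes> a"
proof -
  have gax: "g \<otimes> (a \<otimes> x) = \<zero>" and agx: "a \<otimes> (g \<otimes> x) = \<zero>" if "x \<in> carrier R" for x
    using ga ag g a that by (simp_all add: m_assoc[symmetric])
  \<comment> \<open>Otherwise \<open>D\<close> and \<open>aD\<close> would be a repetition inside \<open>(1 - g)R\<close>.\<close>
  have moved: "x = \<zero>"
    if D: "right_ideal R D" and x: "x \<in> D" and gD: "\<And>d. d \<in> D \<Longrightarrow> g \<otimes> d = \<zero>"
      and inj: "\<And>d. \<lbrakk>d \<in> D; a \<otimes> d = \<zero>\<rbrakk> \<Longrightarrow> d = \<zero>"
      and dis: "\<And>d. \<lbrakk>d \<in> D; a \<otimes> d \<in> D\<rbrakk> \<Longrightarrow> a \<otimes> d = \<zero>" for D x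
  proof -
    define T where "T = {(x, a \<otimes> x) | x. x \<in> D}"
    have T: "partial_iso R T" unfolding T_def by (rule partial_iso_mult[OF a D inj])
    have dom: "Domain T = D" and ran: "Range T = (\<otimes>) a ` D" by (auto simp: T_def)
    have "Domain T \<inter> Range T = {\<zero>}"
    proof
      show "Domain T \<inter> Range T \<subseteq> {\<zero>}" using dis by (auto simp: dom ran)
      show "{\<zero>} \<subseteq> Domain T \<inter> Range T"
        using right_idealD(2)[OF partial_iso_Domain[OF T]]
          right_idealD(2)[OF partial_iso_Range[OF T]] by simp
    qed
    then have "Domain T = {\<zero>}"
      using gD gax right_idealD(1)[OF D] by (intro free[OF T]) (auto simp: dom ran)
    then show ?thesis using x dom by blast
  qed
  let ?K = "right_annihilator R a"
  have K: "right_ideal R ?K" by (rule right_ideal_annihilator[OF a])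
  have Kc: "k \<in> carrier R" and Ka: "a \<otimes> k = \<zero>" if "k \<in> ?K" for k
    using that by (auto simp: right_annihilator_def)
  have KI: "k \<in> ?K" if "k \<in> carrier R" "a \<otimes> k = \<zero>" for k
    using that by (simp add: right_annihilator_def)
  obtain C0 where C0: "right_ideal R C0" "?K \<inter> C0 = {\<zero>}" "essential_right_ideal R (?K <+> C0)"
    by (rule complement_exists[OF K])
  note C0c = right_idealD(1)[OF C0(1)]
  \<comment> \<open>Since \<open>gR \<subseteq> K\<close>, a complement of \<open>K\<close> can be moved into \<open>(1 - g)R\<close>.\<close>
  define C where "C = (\<otimes>) (\<one> \<ominus> g) ` C0"
  have C: "right_ideal R C"
    unfolding C_def using g by (intro right_ideal_image[OF _ C0(1)]) simp
  note Cc = right_idealD(1)[OF C]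
  have sub: "(\<one> \<ominus> g) \<otimes> x = x \<ominus> g \<otimes> x" if "x \<in> carrier R" for x
    using that g by (simp add: minus_eq l_distr l_minus)
  have asub: "a \<otimes> ((\<one> \<ominus> g) \<otimes> x) = a \<otimes> x" if x: "x \<in> carrier R" for x
    using sub[OF x] agx[OF x] x a g by (simp add: minus_eq r_distr r_minus)
  have gsub: "g \<otimes> ((\<one> \<ominus> g) \<otimes> x) = \<zero>" if x: "x \<in> carrier R" for x
  proof -
    have "g \<otimes> (g \<otimes> x) = g \<otimes> x" using gg g x by (simp add: m_assoc[symmetric])
    then show ?thesis using sub[OF x] x g by (simp add: minus_eq r_distr r_minus r_neg)
  qed
  have gC: "g \<otimes> c = \<zero>" if "c \<in> C" for c using that gsub C0c by (auto simp: C_def)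
  have injC: "c = \<zero>" if c: "c \<in> C" "a \<otimes> c = \<zero>" for c
  proof -
    obtain x where x: "x \<in> C0" "c = (\<one> \<ominus> g) \<otimes> x" using c(1) by (auto simp: C_def)
    have "a \<otimes> x = \<zero>" using c(2) x asub[OF C0c[OF x(1)]] by simp
    then have "x = \<zero>" using C0(2) KI[OF C0c[OF x(1)]] x(1) by blast
    then show ?thesis using x(2) g by simp
  qed
  have "?K <+> C0 \<subseteq> C <+> ?K"
  proof
    fix z assume "z \<in> ?K <+> C0"
    then obtain k x where z: "k \<in> ?K" "x \<in> C0" "z = k \<oplus> x" by (rule set_add_memE)
    have c: "k \<in> carrier R" "x \<in> carrier R" using Kc[OF z(1)] C0c[OF z(2)] by simp_all
    have "z = (\<one> \<ominus> g) \<otimes> x \<oplus> (k \<oplus> g \<otimes> x)"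
      using z(3) c g sub[OF c(2)] by (simp add: minus_eq a_ac r_neg1 r_neg2 r_neg)
    moreover have "k \<oplus> g \<otimes> x \<in> ?K"
      using Ka[OF z(1)] agx[OF c(2)] a g c by (intro KI) (simp_all add: r_distr)
    moreover have "(\<one> \<ominus> g) \<otimes> x \<in> C" using z(2) by (simp add: C_def)
    ultimately show "z \<in> C <+> ?K" using set_add_memI by metis
  qed
  then have ess: "essential_right_ideal R (C <+> ?K)"
    by (rule essential_right_ideal_mono[OF C0(3) right_ideal_sum[OF C K]])
  define T where "T = {(x, a \<otimes> x) | x. x \<in> C}"
  have T: "partial_iso R T" unfolding T_def by (rule partial_iso_mult[OF a C injC])
  have domT: "Domain T = C" and ranT: "Range T = (\<otimes>) a ` C" by (auto simp: T_def)
  have aCK: "a \<otimes> c = \<zero>" if c: "c \<in> C" "a \<otimes> c \<in> ?K" for c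
  proof -
    \<comment> \<open>\<open>aD \<subseteq> K\<close> and \<open>D \<subseteq> C\<close> meet in zero only, so \<open>D = 0\<close>.\<close>
    let ?D = "{c \<in> C. a \<otimes> (a \<otimes> c) = \<zero>}"
    have "c = \<zero>"
    proof (rule moved[of ?D])
      show "right_ideal R ?D"
        by (rule right_idealI) (use a right_idealD[OF C] in \<open>auto simp: r_distr m_assoc[symmetric]\<close>)
      show "c \<in> ?D" using c Ka by simp
      show "g \<otimes> d = \<zero>" if "d \<in> ?D" for d using that gC by simp
      show "d = \<zero>" if "d \<in> ?D" "a \<otimes> d = \<zero>" for d using that injC by simp
      show "a \<otimes> d = \<zero>" if "d \<in> ?D" "a \<otimes> d \<in> ?D" for d using that injC by simp
    qed
    then show ?thesis using a by simp
  qed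
  have dom: "Domain T \<inter> Domain (Id_on ?K) = {\<zero>}"
    using injC Ka right_idealD(2)[OF C] right_idealD(2)[OF K] by (auto simp: domT)
  have ran: "Range T \<inter> Range (Id_on ?K) = {\<zero>}"
  proof
    show "Range T \<inter> Range (Id_on ?K) \<subseteq> {\<zero>}" using aCK by (auto simp: ranT)
    show "{\<zero>} \<subseteq> Range T \<inter> Range (Id_on ?K)"
      using right_idealD(2)[OF partial_iso_Range[OF T]] right_idealD(2)[OF K] by simp
  qed
  define Q where "Q = {(x \<oplus> x', y \<oplus> y') | x y x' y'. (x, y) \<in> T \<and> (x', y') \<in> Id_on ?K}"
  note Q = partial_iso_sum[OF T partial_iso_Id_on[OF K] dom ran, folded Q_def]
  have essdom: "essential_right_ideal R (Domain Q)" using Q(2) ess by (simp add: domT)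
  let ?U = "Range Q"
  have U: "right_ideal R ?U" by (rule partial_iso_Range[OF Q(1)])
  note Uc = right_idealD(1)[OF U]
  have KU: "?K \<subseteq> ?U" using Q(5) by blast
  have aCU: "a \<otimes> c \<in> ?U" if "c \<in> C" for c using Q(4) that by (auto simp: T_def)
  have "\<exists>r\<in>carrier R. x \<otimes> r \<in> ?U \<and> x \<otimes> r \<noteq> \<zero>" if x: "x \<in> carrier R" "x \<noteq> \<zero>" for x
  proof (rule ccontr)
    assume neg: "\<not> ?thesis"
    \<comment> \<open>A multiple \<open>y\<close> of \<open>x\<close> lies in \<open>C + K\<close>, hence \<open>ayR \<subseteq> aC\<close> lies in \<open>U\<close>, which \<open>yR\<close> avoids. So \<open>a\<close> moves
      \<open>(1 - g)yR\<close> off itself.\<close>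
    obtain r where r: "r \<in> carrier R" "x \<otimes> r \<in> C <+> ?K" "x \<otimes> r \<noteq> \<zero>"
      using essential_right_idealD(2)[OF ess x] by blast
    define y where "y = x \<otimes> r"
    have y: "y \<in> carrier R" "y \<noteq> \<zero>" using x r by (auto simp: y_def)
    have yU: "y \<otimes> s = \<zero>" if s: "s \<in> carrier R" "y \<otimes> s \<in> ?U" for s
    proof -
      have "y \<otimes> s = x \<otimes> (r \<otimes> s)" using x r s by (simp add: y_def m_assoc)
      then show ?thesis using neg s r by auto
    qed
    obtain c k where ck: "c \<in> C" "k \<in> ?K" "y = c \<oplus> k" using r(2) y_def by (auto elim!: set_add_memE)
    define y' where "y' = (\<one> \<ominus> g) \<otimes> y"
    have y': "y' \<in> carrier R" using y g by (simp add: y'_def)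
    have y's: "y' \<otimes> s = (\<one> \<ominus> g) \<otimes> (y \<otimes> s)" if "s \<in> carrier R" for s
      using that y g by (simp add: y'_def m_assoc)
    have y'U: "y' \<otimes> s = \<zero>" if s: "s \<in> carrier R" "y' \<otimes> s \<in> ?U" for s
    proof -
      have ys: "y \<otimes> s \<in> carrier R" using y s by simp
      have "y' \<otimes> s = y \<otimes> s \<ominus> g \<otimes> (y \<otimes> s)" using y's[OF s(1)] sub[OF ys] by simp
      then have "y \<otimes> s = y' \<otimes> s \<oplus> g \<otimes> (y \<otimes> s)"
        using ys g by (simp add: minus_eq a_assoc l_neg)
      moreover have "g \<otimes> (y \<otimes> s) \<in> ?U" using KU KI agx[OF ys] g ys by blast
      ultimately have "y \<otimes> s \<in> ?U" using right_idealD(3)[OF U s(2)] by metis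
      then have "y \<otimes> s = \<zero>" by (rule yU[OF s(1)])
      then show ?thesis using y's[OF s(1)] g by simp
    qed
    have "y' = \<zero>"
    proof (rule moved[of "(\<otimes>) y' ` carrier R"])
      show "right_ideal R ((\<otimes>) y' ` carrier R)" by (rule right_ideal_principal[OF y'])
      show "y' \<in> (\<otimes>) y' ` carrier R" using y' by (intro image_eqI[of _ _ \<one>]) auto
      fix d assume "d \<in> (\<otimes>) y' ` carrier R"
      then obtain s where s: "s \<in> carrier R" "d = y' \<otimes> s" by blast
      have ys: "y \<otimes> s \<in> carrier R" using y s by simp
      have d: "d \<in> carrier R" using s y' by simp
      show "g \<otimes> d = \<zero>" using s(2) y's[OF s(1)] gsub[OF ys] by simp
      show "d = \<zero>" if "a \<otimes> d = \<zero>" using y'U[OF s(1)] KU KI[OF d that] s(2) by blast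
      have "a \<otimes> d = a \<otimes> (y \<otimes> s)" using s(2) y's[OF s(1)] asub[OF ys] by simp
      also have "\<dots> = a \<otimes> (c \<otimes> s)"
      proof -
        have "a \<otimes> (k \<otimes> s) = \<zero>" using Ka[OF ck(2)] Kc[OF ck(2)] a s by (simp add: m_assoc[symmetric])
        then show ?thesis
          using ck(3) Cc[OF ck(1)] Kc[OF ck(2)] a s by (simp add: l_distr r_distr)
      qed
      finally have aU: "a \<otimes> d \<in> ?U" using aCU[OF right_idealD(4)[OF C ck(1) s(1)]] by simp
      assume "a \<otimes> d \<in> (\<otimes>) y' ` carrier R"
      then obtain s' where "s' \<in> carrier R" "a \<otimes> d = y' \<otimes> s'" by blast
      then show "a \<otimes> d = \<zero>" using aU y'U by metis
    qed
    then have "y \<ominus> g \<otimes> y = \<zero>" using sub[OF y(1)] by (simp add: y'_def)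
    then have "y = g \<otimes> y" using diff_eq_zeroD y(1) g by blast
    then have "y \<in> ?K" using KI[OF y(1)] agx[OF y(1)] by simp
    then have "y \<otimes> \<one> = \<zero>" using yU[OF one_closed] KU y(1) by auto
    then show False using y by simp
  qed
  then have essran: "essential_right_ideal R (Range Q)"
    using U by (simp add: essential_right_ideal_def)
  have conv: "essential_right_ideal R (Domain (Q\<inverse>))" "essential_right_ideal R (Range (Q\<inverse>))"
    using essdom essran by simp_all
  obtain v where v: "v \<in> carrier R" "\<And>x y. (y, x) \<in> Q\<inverse> \<Longrightarrow> v \<otimes> y = x"
    using extend[OF partial_iso_converse[OF Q(1)] conv] by blast
  have "a \<otimes> v \<otimes> a = a"
  proof (rule eq_on_essential[OF _ a ess])
    show "a \<otimes> v \<otimes> a \<in> carrier R" using a v by simp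
    fix z assume "z \<in> C <+> ?K"
    then obtain c k where z: "c \<in> C" "k \<in> ?K" "z = c \<oplus> k" by (rule set_add_memE)
    have zc: "c \<in> carrier R" "k \<in> carrier R" using Cc[OF z(1)] Kc[OF z(2)] by simp_all
    have az: "a \<otimes> z = a \<otimes> c" using z(3) zc a Ka[OF z(2)] by (simp add: r_distr)
    have "(a \<otimes> c, c) \<in> Q\<inverse>" using Q(4) z(1) by (auto simp: T_def)
    then have "v \<otimes> (a \<otimes> c) = c" by (rule v(2))
    then show "a \<otimes> v \<otimes> a \<otimes> z = a \<otimes> z" using az a v(1) zc z(3) by (simp add: m_assoc)
  qed
  then show ?thesis using v(1) by metis
qed

text \<open>
  The maximal repetition \<open>V\<close> is generated by an idempotent \<open>g\<close>, and maximality makes the complement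
  \<open>(1 - g)R\<close> repetition-free. An arbitrary element is reduced to one annihilated by \<open>g\<close> from both
  sides, first from the left and then from the right; idempotent generators of right ideals inside
  \<open>V\<close> provide the two reductions.
\<close>

theorem nonsingular_rigid_ring_regular: "von_neumann_regular R"
proof -
  obtain S where S: "partial_iso R S" and dis: "Domain S \<inter> Range S = {\<zero>}"
    and max: "\<And>T. \<lbrakk>partial_iso R T; Domain T \<inter> Range T = {\<zero>};
        (Domain T <+> Range T) \<inter> (Domain S <+> Range S) = {\<zero>}\<rbrakk> \<Longrightarrow> Domain T = {\<zero>}"
    by (rule maximal_repetition) (rule that)
  define V where "V = Domain S <+> Range S"
  have V: "right_ideal R V"
    unfolding V_def by (rule right_ideal_sum[OF partial_iso_Domain[OF S] partial_iso_Range[OF S]])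
  note Vc = right_idealD(1)[OF V]
  have summand: "\<exists>p\<in>W. \<forall>w\<in>W. p \<otimes> w = w" if W: "right_ideal R W" "W \<subseteq> V" for W
    using repeated_submodule_summand[OF S dis W(1) W(2)[unfolded V_def]] by metis
  obtain g where g: "g \<in> V" "\<And>w. w \<in> V \<Longrightarrow> g \<otimes> w = w" using summand[OF V] by blast
  have gc: "g \<in> carrier R" using Vc g by blast
  have free: "Domain T = {\<zero>}"
    if T: "partial_iso R T" "Domain T \<inter> Range T = {\<zero>}"
      and gT: "\<And>z. z \<in> Domain T \<union> Range T \<Longrightarrow> g \<otimes> z = \<zero>" for T
  proof (rule max[OF T])
    note D = partial_iso_Domain[OF T(1)] and D' = partial_iso_Range[OF T(1)]
    have "z = \<zero>" if z: "z \<in> Domain T <+> Range T" "z \<in> V" for z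
    proof -
      obtain d e where de: "d \<in> Domain T" "e \<in> Range T" "z = d \<oplus> e"
        using z(1) by (rule set_add_memE)
      have "g \<otimes> z = \<zero>"
        using de gT gc right_idealD(1)[OF D de(1)] right_idealD(1)[OF D' de(2)]
        by (simp add: r_distr)
      then show ?thesis using g(2)[OF z(2)] by simp
    qed
    then show "(Domain T <+> Range T) \<inter> (Domain S <+> Range S) = {\<zero>}"
      using right_idealD(2)[OF right_ideal_sum[OF D D']] right_idealD(2)[OF V]
      unfolding V_def by blast
  qed
  have reg0: "\<exists>b\<in>carrier R. a = a \<otimes> b \<otimes> a"
    if "a \<in> carrier R" "g \<otimes> a = \<zero>" "a \<otimes> g = \<zero>" for a
    by (rule repetition_free_regular[OF gc free g(2)[OF g(1)] that])
  have reg1: "\<exists>b\<in>carrier R. a = a \<otimes> b \<otimes> a" if a: "a \<in> carrier R" and ga: "g \<otimes> a = \<zero>" for a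
  proof -
    define W where "W = {w \<in> V. a \<otimes> w = \<zero>}"
    have W: "right_ideal R W"
      by (rule right_idealI)
        (use a right_idealD[OF V] in \<open>auto simp: W_def r_distr m_assoc[symmetric]\<close>)
    obtain p where p: "p \<in> W" "\<And>w. w \<in> W \<Longrightarrow> p \<otimes> w = w" using summand[OF W] by (auto simp: W_def)
    have pc: "p \<in> carrier R" and pV: "p \<in> V" and ap: "a \<otimes> p = \<zero>"
      using p(1) Vc by (auto simp: W_def)
    \<comment> \<open>\<open>V = W \<oplus> D\<close> with \<open>a\<close> injective on \<open>D\<close>, and \<open>aD\<close> misses \<open>V\<close> because of \<open>ga = 0\<close>. So \<open>D\<close> is repeated,
      and some \<open>m \<in> R\<close> inverts \<open>a\<close> on it; then \<open>c = a - ama\<close> annihilates \<open>V\<close>.\<close>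
    define D where "D = {d \<in> V. p \<otimes> d = \<zero>}"
    have D: "right_ideal R D"
      by (rule right_idealI)
        (use pc right_idealD[OF V] in \<open>auto simp: D_def r_distr m_assoc[symmetric]\<close>)
    note Dc = right_idealD(1)[OF D]
    have inj: "d = \<zero>" if "d \<in> D" "a \<otimes> d = \<zero>" for d
      using that p(2)[of d] by (simp add: D_def W_def)
    define T where "T = {(x, a \<otimes> x) | x. x \<in> D}"
    have T: "partial_iso R T" unfolding T_def by (rule partial_iso_mult[OF a D inj])
    have disT: "Domain T \<inter> Range T = {\<zero>}"
    proof
      show "Domain T \<inter> Range T \<subseteq> {\<zero>}"
      proof
        fix d assume d: "d \<in> Domain T \<inter> Range T"
        then obtain d' where d': "d' \<in> D" "d = a \<otimes> d'" by (auto simp: T_def)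
        have "d \<in> V" using d by (auto simp: T_def D_def)
        then have "d = g \<otimes> (a \<otimes> d')" using g(2) d'(2) by simp
        also have "\<dots> = \<zero>" using ga gc a Dc[OF d'(1)] by (simp add: m_assoc[symmetric])
        finally show "d \<in> {\<zero>}" by simp
      qed
      show "{\<zero>} \<subseteq> Domain T \<inter> Range T"
        using right_idealD(2)[OF partial_iso_Domain[OF T]]
          right_idealD(2)[OF partial_iso_Range[OF T]] by simp
    qed
    obtain m where m: "m \<in> carrier R" "\<And>x y. (x, y) \<in> T \<Longrightarrow> m \<otimes> y = x"
      using repeated_right_ideal[OF T disT] by metis
    define c where "c = a \<ominus> a \<otimes> m \<otimes> a"
    have cc: "c \<in> carrier R" using a m by (simp add: c_def)
    have "g \<ominus> p \<otimes> g \<in> D"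
    proof -
      have "p \<otimes> (p \<otimes> g) = p \<otimes> g" using p(2)[OF p(1)] pc gc by (simp add: m_assoc[symmetric])
      then show ?thesis
        using right_idealD(6)[OF V g(1) right_idealD(4)[OF V pV gc]] pc gc
        by (simp add: D_def minus_eq r_distr r_minus r_neg)
    qed
    then have "(g \<ominus> p \<otimes> g, a \<otimes> (g \<ominus> p \<otimes> g)) \<in> T" by (auto simp: T_def)
    then have "m \<otimes> (a \<otimes> (g \<ominus> p \<otimes> g)) = g \<ominus> p \<otimes> g" by (rule m(2))
    moreover have agp: "a \<otimes> (g \<ominus> p \<otimes> g) = a \<otimes> g"
    proof -
      have "a \<otimes> (p \<otimes> g) = \<zero>" using ap a pc gc by (simp add: m_assoc[symmetric])
      then show ?thesis using a pc gc by (simp add: minus_eq r_distr r_minus)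
    qed
    ultimately have "a \<otimes> (m \<otimes> (a \<otimes> g)) = a \<otimes> g" by simp
    then have "c \<otimes> g = \<zero>"
      using a m(1) gc by (simp add: c_def minus_eq l_distr l_minus m_assoc r_neg)
    moreover have "g \<otimes> c = \<zero>"
    proof -
      have "g \<otimes> (a \<otimes> m \<otimes> a) = \<zero>" using ga gc a m(1) by (simp add: m_assoc[symmetric])
      then show ?thesis using ga a m(1) gc by (simp add: c_def minus_eq r_distr r_minus)
    qed
    ultimately have "\<exists>y\<in>carrier R. c = c \<otimes> y \<otimes> c" using reg0[OF cc] by blast
    then show ?thesis by (rule regular_if_reduction_regular[OF a m(1) c_def])
  qed
  have "\<exists>b\<in>carrier R. a = a \<otimes> b \<otimes> a" if a: "a \<in> carrier R" for a
  proof -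
    have ga: "g \<otimes> a \<in> carrier R" using gc a by simp
    have W: "right_ideal R ((\<otimes>) (g \<otimes> a) ` carrier R)" by (rule right_ideal_principal[OF ga])
    have "(\<otimes>) (g \<otimes> a) ` carrier R \<subseteq> V"
      using right_idealD(4)[OF V right_idealD(4)[OF V g(1) a]] by blast
    then obtain p where p: "p \<in> (\<otimes>) (g \<otimes> a) ` carrier R"
        "\<And>w. w \<in> (\<otimes>) (g \<otimes> a) ` carrier R \<Longrightarrow> p \<otimes> w = w"
      using summand[OF W] by blast
    \<comment> \<open>The idempotent generator \<open>gat\<close> of \<open>gaR\<close> shows that subtracting \<open>a(tg)a\<close> kills \<open>ga\<close>.\<close>
    obtain t where t: "t \<in> carrier R" "p = g \<otimes> a \<otimes> t" using p(1) by blast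
    have "g \<otimes> a \<in> (\<otimes>) (g \<otimes> a) ` carrier R" using ga by (intro image_eqI[of _ _ \<one>]) auto
    then have "g \<otimes> a \<otimes> t \<otimes> (g \<otimes> a) = g \<otimes> a" using p(2) t(2) by blast
    then have gat: "g \<otimes> (a \<otimes> (t \<otimes> g) \<otimes> a) = g \<otimes> a" using gc a t(1) by (simp add: m_assoc)
    define c where "c = a \<ominus> a \<otimes> (t \<otimes> g) \<otimes> a"
    have cc: "c \<in> carrier R" using a t gc by (simp add: c_def)
    have "g \<otimes> c = \<zero>"
    proof -
      have "g \<otimes> c = g \<otimes> a \<ominus> g \<otimes> (a \<otimes> (t \<otimes> g) \<otimes> a)"
        using gc a t(1) by (simp add: c_def minus_eq r_distr r_minus)
      then show ?thesis using gat ga by (simp add: minus_eq r_neg)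
    qed
    then have "\<exists>y\<in>carrier R. c = c \<otimes> y \<otimes> c" by (rule reg1[OF cc])
    then show ?thesis
      using regular_if_reduction_regular[OF a _ c_def] t(1) gc by simp
  qed
  then show ?thesis by (simp add: von_neumann_regular_def)
qed

end

theorem theorem4p2:
  fixes R :: "('a, 'r) ring_scheme"
  assumes "right_a_ring TYPE('e) R"
  shows "von_neumann_regular R \<longleftrightarrow> semiprime_ring R"
proof
  have R: "ring R" using assms by (simp add: right_a_ring_def)
  interpret ring R by (rule R)
  show "semiprime_ring R" if "von_neumann_regular R"
    by (rule von_neumann_regular_semiprime[OF that])
  assume semiprime: "semiprime_ring R"
  interpret rigid_ring R
    by unfold_locales (rule a_ring_extend_partial_iso[OF assms])
  interpret nonsingular_rigid_ring R
    by unfold_locales (rule semiprime_nonsingular[OF semiprime])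
  show "von_neumann_regular R" by (rule nonsingular_rigid_ring_regular)
qed

end
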